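(* Let $C$ be a compact Riemann surface of genus $g\ge2$ with a chosen projective coordinate system subordinate to its complex structure and a fixed theta characteristic $K_C^{1/2}$. For $q\in B=H^0(C,K_C^{\otimes2})$, let $\mathcal E(q)$ denote the $\mathcal D$-module $(E_\hbar,\hbar\nabla^\hbar(q))$ associated with the oper family $(E_\hbar,\nabla^\hbar(q))$ corresponding to the point $(E_0,\phi(q))$ of the Hitchin section. Then the semi-classical limit of $\mathcal E(q)$ is the spectral curve $\Sigma\subset T^*C$ of $\phi(q)$, defined by the characteristic equation $\det(\eta-\phi(q))=0$.
   Context: Projective coordinate system: cover $C=\bigcup_\alpha U_\alpha$ by simply connected coordinate neighborhoods with coordinates $z_\alpha$ related by Möbius transformations $z_\alpha=\frac{a_{\alpha\beta}z_\beta+b_{\alpha\beta}}{c_{\alpha\beta}z_\beta+d_{\alpha\beta}}$, with matrices in $SL_2(\mathbb C)$ forming a cocycle; $K_C^{1/2}$ has transition functions $\xi_{\alpha\beta}=c_{\alpha\beta}z_\beta+d_{\alpha\beta}$. $E_0=K_C^{1/2}\oplus K_C^{-1/2}$, $\phi(q)=\begin{bmatrix}0&q\\1&0\end{bmatrix}:E_0\to E_0\otimes K_C$. $E_\hbar$ is the bundle with transition functions $\begin{bmatrix}\xi_{\alpha\beta}&-\hbar\frac{d\xi_{\alpha\beta}}{dz_\beta}\\0&\xi_{\alpha\beta}^{-1}\end{bmatrix}$, and for $\hbar\ne0$ the holomorphic connection $\nabla^\hbar(q)$ in $E_\hbar$ is $d-\frac1\hbar\phi_\alpha(q)dz_\alpha$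 on $U_\alpha$, where $\phi_\alpha(q)=\begin{bmatrix}0&(q)_\alpha\\1&0\end{bmatrix}$ and $q=(q)_\alpha dz_\alpha^2$. Flat sections of $\hbar\nabla^\hbar(q)$ on $U_\alpha$ have the form $\begin{bmatrix}\hbar\psi'\\\psi\end{bmatrix}$, and the flatness equation is equivalent to the second order equation $\hbar^2\psi''-(q)_\alpha\psi=0$ for a local section $\psi$ of $K_C^{-1/2}$, of the same form on every $U_\alpha$. The semi-classical limit of $\mathcal E(q)$ is the curve in $T^*C$ given over $U_\alpha$ by the zero locus, in the fiber coordinate $y$, of $$\lim_{\hbar\to0}e^{-\frac1\hbar S_0(z_\alpha)}\Big[\hbar^2\Big(\frac{d}{dz_\alpha}\Big)^2-(q)_\alpha\Big]e^{\frac1\hbar S_0(z_\alpha)},$$ where $S_0$ is a holomorphic function on $U_\alpha$ with $dS_0=y\,dz_\alpha$ giving the local trivialization of $T^*C$ over $U_\alpha$. (Equivalently: conjugate $\hbar\nabla^\hbar(q)$ by the scalar matrix $e^{-\frac1\hbar S_0}I_{2\times2}$, take the determinant, and let $\hbar\to0$.) With $\pi:T^*C\to C$ the projection and $\eta\in H^0(T^*C,\pi^*K_C)$ the tautological section, the spectral curve of $\phi(q)$ is the divisor of zeros in $T^*C$ of $\det(\eta-\pi^*\phi(q))\in \pi^*K_C^{\otimes2}$. *)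

theory Defs
  imports "HOL-Complex_Analysis.Complex_Analysis" "HOL-Homology.Homology"
begin

no_notation fps_nth (infixl "$" 75)

section \<open>Riemann surfaces\<close>

text \<open>A chart is a pair \<open>(U, z)\<close>; the values of \<open>z\<close> off \<open>U\<close> are irrelevant. A function \<open>f\<close> is
  holomorphic on \<open>W \<subseteq> U\<close>, and has derivative \<open>df/dz\<close>, when this holds for \<open>f \<circ> z\<inverse>\<close>.\<close>

type_synonym 'p chart = "'p set \<times> ('p \<Rightarrow> complex)"

definition is_chart :: "'p topology \<Rightarrow> 'p chart \<Rightarrow> bool" where
  "is_chart T c \<longleftrightarrow>
     openin T (fst c) \<and> open (snd c ` fst c) \<and>
     homeomorphic_map (subtopology T (fst c)) (top_of_set (snd c ` fst c)) (snd c)"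

definition chart_inv :: "'p chart \<Rightarrow> complex \<Rightarrow> 'p" where
  "chart_inv c = inv_into (fst c) (snd c)"

definition chart_hol :: "'p chart \<Rightarrow> 'p set \<Rightarrow> ('p \<Rightarrow> complex) \<Rightarrow> bool" where
  "chart_hol c W f \<longleftrightarrow> (f \<circ> chart_inv c) holomorphic_on (snd c ` W)"

definition chart_deriv :: "'p chart \<Rightarrow> ('p \<Rightarrow> complex) \<Rightarrow> 'p \<Rightarrow> complex" where
  "chart_deriv c f p = deriv (f \<circ> chart_inv c) (snd c p)"

lemma chart_inv_left: "is_chart T c \<Longrightarrow> p \<in> fst c \<Longrightarrow> chart_inv c (snd c p) = p"
  unfolding is_chart_def chart_inv_def
  by (metis homeomorphic_imp_injective_map inv_into_f_f openin_subset topspace_subtopology_subset)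

lemma chart_inj: "is_chart T c \<Longrightarrow> inj_on (snd c) (fst c)"
  unfolding is_chart_def
  by (metis homeomorphic_imp_injective_map openin_subset topspace_subtopology_subset)

lemma open_chart_image:
  assumes c: "is_chart T c" and W: "openin T W" "W \<subseteq> fst c"
  shows "open (snd c ` W)"
proof -
  have "openin (subtopology T (fst c)) W"
    using W by (metis openin_subtopology_Int Int_absorb2 openin_Int_open)
  then have "openin (top_of_set (snd c ` fst c)) (snd c ` W)"
    using c homeomorphic_imp_open_map open_map_def unfolding is_chart_def by blast
  then show ?thesis
    using c openin_open_trans unfolding is_chart_def by blast
qed

lemma chart_has_deriv:
  assumes "is_chart T c" "openin T W" "W \<subseteq> fst c" "chart_hol c W f" "p \<in> W"
  shows "((f \<circ> chart_inv c) has_field_derivative chart_deriv c f p) (at (snd c p))"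
  using assms open_chart_image unfolding chart_hol_def chart_deriv_def
  by (meson holomorphic_derivI imageI)

lemma chart_hol_deriv:
  assumes c: "is_chart T c" and W: "openin T W" "W \<subseteq> fst c" and f: "chart_hol c W f"
  shows "chart_hol c W (chart_deriv c f)"
proof -
  have "deriv (f \<circ> chart_inv c) holomorphic_on snd c ` W"
    using f open_chart_image[OF c W] holomorphic_deriv unfolding chart_hol_def by blast
  then show ?thesis
    unfolding chart_hol_def chart_deriv_def
    by (rule holomorphic_transform) (use chart_inv_left[OF c] W in auto)
qed

definition charts_compatible :: "'p chart \<Rightarrow> 'p chart \<Rightarrow> bool" where
  "charts_compatible c d \<longleftrightarrow>
     chart_hol d (fst c \<inter> fst d) (snd c) \<and> chart_hol c (fst c \<inter> fst d) (snd d)"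

lemma chart_deriv_eqI:
  assumes c: "is_chart T c" and W: "openin T W" "W \<subseteq> fst c" "p \<in> W"
    and eq: "\<And>p'. p' \<in> W \<Longrightarrow> f p' = G (snd c p')"
    and G: "(G has_field_derivative D) (at (snd c p))"
  shows "chart_deriv c f p = D"
proof -
  have "((f \<circ> chart_inv c) has_field_derivative D) (at (snd c p))"
  proof (rule has_field_derivative_transform_within_open[OF G])
    show "open (snd c ` W)" using open_chart_image[OF c] W by blast
  qed (use W eq chart_inv_left[OF c] in auto)
  then show ?thesis
    unfolding chart_deriv_def by (rule DERIV_imp_deriv)
qed

lemma chart_deriv_chain:
  assumes c: "is_chart T c" and d: "is_chart T d" and cd: "charts_compatible c d"
    and W: "openin T W" "W \<subseteq> fst c \<inter> fst d" "p \<in> W" and f: "chart_hol c W f"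
  shows "chart_deriv d f p = chart_deriv c f p * chart_deriv d (snd c) p"
proof (rule chart_deriv_eqI[OF d W(1)])
  let ?\<tau> = "snd c \<circ> chart_inv d"
  have oc: "openin T (fst c \<inter> fst d)" using c d by (auto simp: is_chart_def)
  have "(?\<tau> has_field_derivative chart_deriv d (snd c) p) (at (snd d p))"
    by (rule chart_has_deriv[OF d oc]) (use cd W in \<open>auto simp: charts_compatible_def\<close>)
  moreover have "((f \<circ> chart_inv c) has_field_derivative chart_deriv c f p) (at (?\<tau> (snd d p)))"
    using chart_has_deriv[OF c W(1) _ f W(3)] chart_inv_left[OF d, of p] W by auto
  ultimately show "(((f \<circ> chart_inv c) \<circ> ?\<tau>) has_field_derivative
      chart_deriv c f p * chart_deriv d (snd c) p) (at (snd d p))"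
    by (rule DERIV_chain[rotated])
  show "f p' = ((f \<circ> chart_inv c) \<circ> ?\<tau>) (snd d p')" if "p' \<in> W" for p'
  proof -
    have "p' \<in> fst c" "p' \<in> fst d" using that W by auto
    then show ?thesis using chart_inv_left[OF d, of p'] chart_inv_left[OF c, of p'] by simp
  qed
qed (use W in auto)

lemma chart_hol_transfer:
  assumes c: "is_chart T c" and d: "is_chart T d" and cd: "charts_compatible c d"
    and W: "W \<subseteq> fst c \<inter> fst d" and f: "chart_hol d W f"
  shows "chart_hol c W f"
proof -
  have *: "chart_inv c (snd c p) = p" "chart_inv d (snd d p) = p" if "p \<in> W" for p
    using chart_inv_left[OF d, of p] chart_inv_left[OF c, of p] that W by auto
  have "(snd d \<circ> chart_inv c) holomorphic_on snd c ` W"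
    using cd W holomorphic_on_subset unfolding charts_compatible_def chart_hol_def
    by (meson image_mono)
  then have "((f \<circ> chart_inv d) \<circ> (snd d \<circ> chart_inv c)) holomorphic_on snd c ` W"
    by (rule holomorphic_on_compose_gen) (use f * in \<open>auto simp: chart_hol_def\<close>)
  then show ?thesis
    unfolding chart_hol_def by (rule holomorphic_transform) (auto simp: *)
qed

record 'p surface =
  points :: "'p topology"
  atlas :: "'p chart set"

text \<open>The complex structure is a maximal holomorphic atlas. Second countability is not listed: it
  follows from the other axioms (and is immediate in the compact case).\<close>

definition riemann_surface :: "'p surface \<Rightarrow> bool" where
  "riemann_surface C \<longleftrightarrow>
     Hausdorff_space (points C) \<and> connected_space (points C) \<and> topspace (points C) \<noteq> {} \<and>
     (\<forall>c\<in>atlas C. is_chart (points C) c) \<and>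
     (\<Union>c\<in>atlas C. fst c) = topspace (points C) \<and>
     (\<forall>c\<in>atlas C. \<forall>d\<in>atlas C. charts_compatible c d) \<and>
     (\<forall>c. is_chart (points C) c \<and> (\<forall>d\<in>atlas C. charts_compatible c d) \<longrightarrow> c \<in> atlas C)"

definition compact_riemann_surface :: "'p surface \<Rightarrow> bool" where
  "compact_riemann_surface C \<longleftrightarrow> riemann_surface C \<and> compact_space (points C)"

text \<open>\<open>H\<^sub>1(C, \<int>) \<cong> \<int>\<^sup>2\<^sup>g\<close>\<close>

definition has_genus :: "'p surface \<Rightarrow> nat \<Rightarrow> bool" where
  "has_genus C g \<longleftrightarrow>
     homology_group 1 (points C) \<cong> free_Abelian_group {..<2 * g}"

text \<open>\<open>H\<^sup>0(C, K\<^sub>C\<^sup>n)\<close>: an element \<open>\<omega>\<close> is recorded by its components, \<open>\<omega> = \<omega>\<^sub>c dz\<^sub>c\<^sup>n\<close> on each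
  chart \<open>c\<close>; values at meaningless arguments are normalised to \<open>0\<close>.\<close>

definition H0_K :: "'p surface \<Rightarrow> nat \<Rightarrow> ('p chart \<Rightarrow> 'p \<Rightarrow> complex) set" where
  "H0_K C n = {\<omega>.
     (\<forall>c\<in>atlas C. chart_hol c (fst c) (\<omega> c)) \<and>
     (\<forall>c\<in>atlas C. \<forall>d\<in>atlas C. \<forall>p\<in>fst c \<inter> fst d.
        \<omega> d p = \<omega> c p * chart_deriv d (snd c) p ^ n) \<and>
     (\<forall>c p. \<not> (c \<in> atlas C \<and> p \<in> fst c) \<longrightarrow> \<omega> c p = 0)}"


section \<open>The cotangent bundle and divisors on it\<close>

text \<open>A point of \<open>T\<^sup>*C\<close> is \<open>(p, y)\<close>, standing for the covector equal to \<open>y\<^sub>c dz\<^sub>c\<close> in every chart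
  \<open>c\<close> at \<open>p\<close>. Thus \<open>\<pi> = fst\<close>.\<close>

type_synonym 'p covector = "'p \<times> ('p chart \<Rightarrow> complex)"

definition Tstar :: "'p surface \<Rightarrow> 'p covector set" where
  "Tstar C = {(p, y).
     p \<in> topspace (points C) \<and>
     (\<forall>c\<in>atlas C. \<forall>d\<in>atlas C. p \<in> fst c \<inter> fst d \<longrightarrow> y d = y c * chart_deriv d (snd c) p) \<and>
     (\<forall>c. \<not> (c \<in> atlas C \<and> p \<in> fst c) \<longrightarrow> y c = 0)}"

text \<open>The component, in the frame \<open>dz\<^sub>c\<close>, of the tautological section \<open>\<eta>\<close> of \<open>\<pi>\<^sup>*K\<^sub>C\<close>, that is,
  the fibre coordinate over \<open>c\<close>.\<close>

definition taut :: "'p chart \<Rightarrow> 'p covector \<Rightarrow> complex" where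
  "taut c x = snd x c"

definition Tover :: "'p surface \<Rightarrow> 'p chart \<Rightarrow> 'p covector set" where
  "Tover C c = {x \<in> Tstar C. fst x \<in> fst c}"

definition Tcoord :: "'p chart \<Rightarrow> 'p covector \<Rightarrow> complex \<times> complex" where
  "Tcoord c x = (snd c (fst x), taut c x)"

definition Topen :: "'p surface \<Rightarrow> 'p covector set \<Rightarrow> bool" where
  "Topen C W \<longleftrightarrow> W \<subseteq> Tstar C \<and> (\<forall>c\<in>atlas C. open (Tcoord c ` (W \<inter> Tover C c)))"

text \<open>Holomorphy in two variables, on open sets: the Frechet derivative exists and is
  complex linear.\<close>

definition holomorphic2_on :: "(complex \<times> complex \<Rightarrow> complex) \<Rightarrow> (complex \<times> complex) set \<Rightarrow> bool" where
  "holomorphic2_on f S \<longleftrightarrow>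
     (\<forall>v\<in>S. \<exists>a b. (f has_derivative (\<lambda>h. a * fst h + b * snd h)) (at v))"

definition Thol :: "'p surface \<Rightarrow> 'p covector set \<Rightarrow> ('p covector \<Rightarrow> complex) \<Rightarrow> bool" where
  "Thol C W f \<longleftrightarrow>
     (\<forall>c\<in>atlas C. holomorphic2_on (f \<circ> inv_into (Tover C c) (Tcoord c)) (Tcoord c ` (W \<inter> Tover C c)))"

text \<open>An effective (Cartier) divisor is the set of all its local equations \<open>(W, f)\<close>: two local
  equations differ locally by an invertible holomorphic factor, and the set is maximal with this
  property. Multiplicities are therefore recorded; the underlying curve is the support.\<close>

type_synonym 'p local_eq = "'p covector set \<times> ('p covector \<Rightarrow> complex)"

definition local_equation :: "'p surface \<Rightarrow> 'p local_eq \<Rightarrow> bool" where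
  "local_equation C e \<longleftrightarrow> Topen C (fst e) \<and> Thol C (fst e) (snd e) \<and>
     (\<forall>N. Topen C N \<and> N \<subseteq> fst e \<and> N \<noteq> {} \<longrightarrow> (\<exists>x\<in>N. snd e x \<noteq> 0))"

definition same_divisor :: "'p surface \<Rightarrow> 'p local_eq \<Rightarrow> 'p local_eq \<Rightarrow> bool" where
  "same_divisor C e e' \<longleftrightarrow>
     (\<forall>x\<in>fst e \<inter> fst e'. \<exists>N u. Topen C N \<and> x \<in> N \<and> N \<subseteq> fst e \<inter> fst e' \<and> Thol C N u \<and>
        (\<forall>x'\<in>N. u x' \<noteq> 0 \<and> snd e x' = u x' * snd e' x'))"

definition effective_divisor :: "'p surface \<Rightarrow> 'p local_eq set \<Rightarrow> bool" where
  "effective_divisor C Z \<longleftrightarrow>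
     (\<forall>e\<in>Z. local_equation C e) \<and>
     (\<Union>e\<in>Z. fst e) = Tstar C \<and>
     (\<forall>e\<in>Z. \<forall>e'\<in>Z. same_divisor C e e') \<and>
     (\<forall>e. local_equation C e \<and> (\<forall>e'\<in>Z. same_divisor C e e') \<longrightarrow> e \<in> Z)"

definition support :: "'p local_eq set \<Rightarrow> 'p covector set" where
  "support Z = {x. \<exists>e\<in>Z. x \<in> fst e \<and> snd e x = 0}"

lemma support_local_equation:
  assumes "effective_divisor C Z" "e \<in> Z" "x \<in> fst e"
  shows "x \<in> support Z \<longleftrightarrow> snd e x = 0"
proof
  assume "x \<in> support Z"
  then obtain e' where e': "e' \<in> Z" "x \<in> fst e'" "snd e' x = 0"
    by (auto simp: support_def)
  have "same_divisor C e e'"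
    using assms e' by (auto simp: effective_divisor_def)
  moreover have "x \<in> fst e \<inter> fst e'"
    using assms e' by simp
  ultimately obtain N u where "x \<in> N" "\<forall>x'\<in>N. u x' \<noteq> 0 \<and> snd e x' = u x' * snd e' x'"
    unfolding same_divisor_def by blast
  then show "snd e x = 0"
    using e' by simp
qed (use assms in \<open>auto simp: support_def\<close>)


section \<open>Projective coordinates and theta characteristics\<close>

record ('i, 'p) projective_coords =
  index :: "'i set"
  pchart :: "'i \<Rightarrow> 'p chart"
  moebius_mat :: "'i \<Rightarrow> 'i \<Rightarrow> complex^2^2"

definition xi :: "('i, 'p) projective_coords \<Rightarrow> 'i \<Rightarrow> 'i \<Rightarrow> 'p \<Rightarrow> complex" where
  "xi P \<alpha> \<beta> p = moebius_mat P \<alpha> \<beta> $ 2 $ 1 * snd (pchart P \<beta>) p + moebius_mat P \<alpha> \<beta> $ 2 $ 2"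

definition projective_coordinate_system :: "'p surface \<Rightarrow> ('i, 'p) projective_coords \<Rightarrow> bool" where
  "projective_coordinate_system C P \<longleftrightarrow>
     (\<forall>\<alpha>\<in>index P. pchart P \<alpha> \<in> atlas C \<and>
        simply_connected (snd (pchart P \<alpha>) ` fst (pchart P \<alpha>))) \<and>
     (\<Union>\<alpha>\<in>index P. fst (pchart P \<alpha>)) = topspace (points C) \<and>
     (\<forall>\<alpha>\<in>index P. \<forall>\<beta>\<in>index P. det (moebius_mat P \<alpha> \<beta>) = 1 \<and>
        (\<forall>p\<in>fst (pchart P \<alpha>) \<inter> fst (pchart P \<beta>).
           xi P \<alpha> \<beta> p \<noteq> 0 \<and>
           snd (pchart P \<alpha>) p =
             (moebius_mat P \<alpha> \<beta> $ 1 $ 1 * snd (pchart P \<beta>) p + moebius_mat P \<alpha> \<beta> $ 1 $ 2) / xi P \<alpha> \<beta> p)) \<and>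
     (\<forall>\<alpha>\<in>index P. \<forall>\<beta>\<in>index P. \<forall>\<gamma>\<in>index P.
        fst (pchart P \<alpha>) \<inter> fst (pchart P \<beta>) \<inter> fst (pchart P \<gamma>) \<noteq> {} \<longrightarrow>
        moebius_mat P \<alpha> \<gamma> = moebius_mat P \<alpha> \<beta> ** moebius_mat P \<beta> \<gamma>)"

text \<open>Transition functions \<open>g\<^sub>\<alpha>\<^sub>\<beta>\<close> relate components by \<open>s\<^sub>\<alpha> = g\<^sub>\<alpha>\<^sub>\<beta> s\<^sub>\<beta>\<close>; hence those of \<open>K\<^sub>C\<close> are
  \<open>dz\<^sub>\<beta>/dz\<^sub>\<alpha>\<close>, and \<open>\<kappa>\<close> is the cocycle of a square root of \<open>K\<^sub>C\<close>.\<close>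

definition theta_characteristic ::
  "('i, 'p) projective_coords \<Rightarrow> ('i \<Rightarrow> 'i \<Rightarrow> 'p \<Rightarrow> complex) \<Rightarrow> bool" where
  "theta_characteristic P \<kappa> \<longleftrightarrow>
     (\<forall>\<alpha>\<in>index P. \<forall>\<beta>\<in>index P.
        chart_hol (pchart P \<beta>) (fst (pchart P \<alpha>) \<inter> fst (pchart P \<beta>)) (\<kappa> \<alpha> \<beta>) \<and>
        (\<forall>p\<in>fst (pchart P \<alpha>) \<inter> fst (pchart P \<beta>).
           \<kappa> \<alpha> \<beta> p \<noteq> 0 \<and> (\<kappa> \<alpha> \<beta> p)\<^sup>2 = chart_deriv (pchart P \<alpha>) (snd (pchart P \<beta>)) p)) \<and>
     (\<forall>\<alpha>\<in>index P. \<forall>\<beta>\<in>index P. \<forall>\<gamma>\<in>index P.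
        \<forall>p\<in>fst (pchart P \<alpha>) \<inter> fst (pchart P \<beta>) \<inter> fst (pchart P \<gamma>).
           \<kappa> \<alpha> \<gamma> p = \<kappa> \<alpha> \<beta> p * \<kappa> \<beta> \<gamma> p)"


section \<open>The Hitchin section and its spectral curves\<close>

text \<open>A Higgs bundle of rank 2 is given by transition matrices and the local matrices \<open>\<phi>\<^sub>\<alpha>\<close> of the
  Higgs field \<open>\<phi>\<^sub>\<alpha> dz\<^sub>\<alpha>\<close>.\<close>

type_synonym ('i, 'p) vbundle = "'i \<Rightarrow> 'i \<Rightarrow> 'p \<Rightarrow> complex^2^2"
type_synonym ('i, 'p) higgs = "('i, 'p) vbundle \<times> ('i \<Rightarrow> 'p \<Rightarrow> complex^2^2)"

definition E_0 :: "('i \<Rightarrow> 'i \<Rightarrow> 'p \<Rightarrow> complex) \<Rightarrow> ('i, 'p) vbundle" where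
  "E_0 \<kappa> \<alpha> \<beta> p = vector [vector [\<kappa> \<alpha> \<beta> p, 0], vector [0, inverse (\<kappa> \<alpha> \<beta> p)]]"

definition phi ::
  "('i, 'p) projective_coords \<Rightarrow> ('p chart \<Rightarrow> 'p \<Rightarrow> complex) \<Rightarrow> 'i \<Rightarrow> 'p \<Rightarrow> complex^2^2" where
  "phi P q \<alpha> p = vector [vector [0, q (pchart P \<alpha>) p], vector [1, 0]]"

definition hitchin_section ::
  "('i, 'p) projective_coords \<Rightarrow> ('i \<Rightarrow> 'i \<Rightarrow> 'p \<Rightarrow> complex) \<Rightarrow> ('p chart \<Rightarrow> 'p \<Rightarrow> complex) \<Rightarrow> ('i, 'p) higgs" where
  "hitchin_section P \<kappa> q = (E_0 \<kappa>, phi P q)"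

text \<open>The section \<open>det(\<eta> - \<pi>\<^sup>*\<phi>)\<close> of \<open>\<pi>\<^sup>*K\<^sub>C\<^sup>2\<close>, in the frame \<open>dz\<^sub>\<alpha>\<^sup>2\<close> over \<open>U\<^sub>\<alpha>\<close>.\<close>

definition char_section ::
  "('i, 'p) projective_coords \<Rightarrow> ('i, 'p) higgs \<Rightarrow> 'i \<Rightarrow> 'p covector \<Rightarrow> complex" where
  "char_section P H \<alpha> x = det (mat (taut (pchart P \<alpha>) x) - snd H \<alpha> (fst x))"

text \<open>The divisor of zeros of a section of a line bundle on \<open>T\<^sup>*C\<close> which is trivialised over the
  sets \<open>T\<^sup>*U\<^sub>\<alpha>\<close>.\<close>

definition zero_divisor_of ::
  "'p surface \<Rightarrow> ('i, 'p) projective_coords \<Rightarrow> ('i \<Rightarrow> 'p covector \<Rightarrow> complex) \<Rightarrow> 'p local_eq set" where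
  "zero_divisor_of C P s = {e. local_equation C e \<and>
     (\<forall>\<alpha>\<in>index P. same_divisor C e (Tover C (pchart P \<alpha>), s \<alpha>))}"

definition spectral_curve ::
  "'p surface \<Rightarrow> ('i, 'p) projective_coords \<Rightarrow> ('i, 'p) higgs \<Rightarrow> 'p local_eq set" where
  "spectral_curve C P H = zero_divisor_of C P (char_section P H)"


section \<open>The oper family and its semi-classical limit\<close>

text \<open>An \<open>\<hbar>\<close>-family: transition matrices and, on \<open>U\<^sub>\<alpha>\<close>, an operator acting on column vectors of
  functions. The operator is the coefficient of \<open>dz\<^sub>\<alpha>\<close>.\<close>

record ('i, 'p) hbar_module =
  hbundle :: "complex \<Rightarrow> ('i, 'p) vbundle"
  hop :: "complex \<Rightarrow> 'i \<Rightarrow> ('p \<Rightarrow> complex^2) \<Rightarrow> 'p \<Rightarrow> complex^2"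

definition E_hbar ::
  "('i, 'p) projective_coords \<Rightarrow> ('i \<Rightarrow> 'i \<Rightarrow> 'p \<Rightarrow> complex) \<Rightarrow> complex \<Rightarrow> ('i, 'p) vbundle" where
  "E_hbar P \<kappa> h \<alpha> \<beta> p =
     vector [vector [\<kappa> \<alpha> \<beta> p, - h * chart_deriv (pchart P \<beta>) (\<kappa> \<alpha> \<beta>) p],
             vector [0, inverse (\<kappa> \<alpha> \<beta> p)]]"

definition oper_connection ::
  "('i, 'p) projective_coords \<Rightarrow> ('p chart \<Rightarrow> 'p \<Rightarrow> complex) \<Rightarrow>
   complex \<Rightarrow> 'i \<Rightarrow> ('p \<Rightarrow> complex^2) \<Rightarrow> 'p \<Rightarrow> complex^2" where
  "oper_connection P q h \<alpha> s p =
     (\<chi> i. chart_deriv (pchart P \<alpha>) (\<lambda>p'. s p' $ i) p) - (1 / h) *s (phi P q \<alpha> p *v s p)"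

definition oper_module ::
  "('i, 'p) projective_coords \<Rightarrow> ('i \<Rightarrow> 'i \<Rightarrow> 'p \<Rightarrow> complex) \<Rightarrow> ('p chart \<Rightarrow> 'p \<Rightarrow> complex) \<Rightarrow>
   ('i, 'p) hbar_module" where
  "oper_module P \<kappa> q =
     \<lparr>hbundle = E_hbar P \<kappa>, hop = (\<lambda>h \<alpha> s p. h *s oper_connection P q h \<alpha> s p)\<rparr>"

text \<open>The scalar operator of the flatness equation: flat sections are \<open>[\<hbar>\<psi>', \<psi>]\<close>, and the first
  row of the system applied to this vector is the second order operator in \<open>\<psi>\<close>. For the oper family
  it is \<open>\<hbar>\<^sup>2(d/dz\<^sub>\<alpha>)\<^sup>2 - (q)\<^sub>\<alpha>\<close>, and the second row vanishes identically; see below.\<close>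

definition jet ::
  "('i, 'p) projective_coords \<Rightarrow> complex \<Rightarrow> 'i \<Rightarrow> ('p \<Rightarrow> complex) \<Rightarrow> 'p \<Rightarrow> complex^2" where
  "jet P h \<alpha> \<psi> p = vector [h * chart_deriv (pchart P \<alpha>) \<psi> p, \<psi> p]"

definition scalar_op ::
  "('i, 'p) projective_coords \<Rightarrow> ('i, 'p) hbar_module \<Rightarrow>
   complex \<Rightarrow> 'i \<Rightarrow> ('p \<Rightarrow> complex) \<Rightarrow> 'p \<Rightarrow> complex" where
  "scalar_op P E h \<alpha> \<psi> p = hop E h \<alpha> (jet P h \<alpha> \<psi>) p $ 1"

text \<open>The value at a covector \<open>x = y dz\<^sub>\<alpha>\<close> is computed with any \<open>S\<^sub>0\<close> on \<open>U\<^sub>\<alpha>\<close> whose differential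
  at \<open>\<pi>(x)\<close> is \<open>x\<close>; the limit is required to exist and to depend on \<open>x\<close> only.\<close>

definition semiclassical_symbol ::
  "'p surface \<Rightarrow> ('i, 'p) projective_coords \<Rightarrow> ('i, 'p) hbar_module \<Rightarrow>
   'i \<Rightarrow> ('p covector \<Rightarrow> complex) \<Rightarrow> bool" where
  "semiclassical_symbol C P E \<alpha> F \<longleftrightarrow>
     (\<forall>x\<in>Tover C (pchart P \<alpha>). \<forall>S.
        chart_hol (pchart P \<alpha>) (fst (pchart P \<alpha>)) S \<and>
        chart_deriv (pchart P \<alpha>) S (fst x) = taut (pchart P \<alpha>) x \<longrightarrow>
        ((\<lambda>h. exp (- (1 / h) * S (fst x)) *
               scalar_op P E h \<alpha> (\<lambda>p. exp ((1 / h) * S p)) (fst x)) \<longlongrightarrow> F x) (at 0))"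

definition semiclassical_limit ::
  "'p surface \<Rightarrow> ('i, 'p) projective_coords \<Rightarrow> ('i, 'p) hbar_module \<Rightarrow> 'p local_eq set \<Rightarrow> bool" where
  "semiclassical_limit C P E Z \<longleftrightarrow> effective_divisor C Z \<and>
     (\<forall>\<alpha>\<in>index P. \<exists>F. semiclassical_symbol C P E \<alpha> F \<and> (Tover C (pchart P \<alpha>), F) \<in> Z)"


section \<open>Consistency of the definitions\<close>

text \<open>The scalar operator is \<open>\<hbar>\<^sup>2(d/dz\<^sub>\<alpha>)\<^sup>2 - (q)\<^sub>\<alpha>\<close>, and its equation is equivalent to flatness; the Higgs
  field is a section of \<open>End E\<^sub>0 \<otimes> K\<^sub>C\<close>; \<open>E\<^sub>\<hbar>\<close> is a bundle, and the local connections glue to a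
  connection in it.\<close>

lemma oper_row1:
  "hop (oper_module P \<kappa> q) h \<alpha> s p $ 1 =
     h * chart_deriv (pchart P \<alpha>) (\<lambda>p. s p $ 1) p - h * (1 / h) * (q (pchart P \<alpha>) p * s p $ 2)"
  by (simp add: oper_module_def oper_connection_def phi_def matrix_vector_mult_def sum_2 algebra_simps)

lemma oper_row2:
  "hop (oper_module P \<kappa> q) h \<alpha> s p $ 2 =
     h * chart_deriv (pchart P \<alpha>) (\<lambda>p. s p $ 2) p - h * (1 / h) * s p $ 1"
  by (simp add: oper_module_def oper_connection_def phi_def matrix_vector_mult_def sum_2 algebra_simps)

context
  fixes C :: "'p surface" and P :: "('i, 'p) projective_coords"
    and \<kappa> :: "'i \<Rightarrow> 'i \<Rightarrow> 'p \<Rightarrow> complex" and q :: "'p chart \<Rightarrow> 'p \<Rightarrow> complex"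
  assumes C: "riemann_surface C" and P: "projective_coordinate_system C P"
    and \<kappa>: "theta_characteristic P \<kappa>" and q: "q \<in> H0_K C 2"
    and xi: "\<And>\<alpha> \<beta> p. \<alpha> \<in> index P \<Longrightarrow> \<beta> \<in> index P \<Longrightarrow>
               p \<in> fst (pchart P \<alpha>) \<inter> fst (pchart P \<beta>) \<Longrightarrow> \<kappa> \<alpha> \<beta> p = xi P \<alpha> \<beta> p"
begin

lemma pchart_atlas: "\<alpha> \<in> index P \<Longrightarrow> pchart P \<alpha> \<in> atlas C"
  using P by (auto simp: projective_coordinate_system_def)

lemma atlas_chart: "c \<in> atlas C \<Longrightarrow> is_chart (points C) c"
  using C by (auto simp: riemann_surface_def)

lemma moebius_mat_props:
  assumes "\<alpha> \<in> index P" "\<beta> \<in> index P"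
  shows "det (moebius_mat P \<alpha> \<beta>) = 1"
    and "p \<in> fst (pchart P \<alpha>) \<inter> fst (pchart P \<beta>) \<Longrightarrow> snd (pchart P \<alpha>) p =
      (moebius_mat P \<alpha> \<beta> $ 1 $ 1 * snd (pchart P \<beta>) p + moebius_mat P \<alpha> \<beta> $ 1 $ 2) / xi P \<alpha> \<beta> p"
proof -
  have *: "\<forall>\<alpha>\<in>index P. \<forall>\<beta>\<in>index P. det (moebius_mat P \<alpha> \<beta>) = 1 \<and>
        (\<forall>p\<in>fst (pchart P \<alpha>) \<inter> fst (pchart P \<beta>).
           xi P \<alpha> \<beta> p \<noteq> 0 \<and>
           snd (pchart P \<alpha>) p =
             (moebius_mat P \<alpha> \<beta> $ 1 $ 1 * snd (pchart P \<beta>) p + moebius_mat P \<alpha> \<beta> $ 1 $ 2) / xi P \<alpha> \<beta> p)"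
    using P unfolding projective_coordinate_system_def by (elim conjE)
  show "det (moebius_mat P \<alpha> \<beta>) = 1"
    using * assms by blast
  show "snd (pchart P \<alpha>) p =
      (moebius_mat P \<alpha> \<beta> $ 1 $ 1 * snd (pchart P \<beta>) p + moebius_mat P \<alpha> \<beta> $ 1 $ 2) / xi P \<alpha> \<beta> p"
    if "p \<in> fst (pchart P \<alpha>) \<inter> fst (pchart P \<beta>)"
    using * assms that by blast
qed

lemma moebius_mat_cocycle:
  assumes "\<alpha> \<in> index P" "\<beta> \<in> index P" "\<gamma> \<in> index P"
    and "p \<in> fst (pchart P \<alpha>) \<inter> fst (pchart P \<beta>) \<inter> fst (pchart P \<gamma>)"
  shows "moebius_mat P \<alpha> \<gamma> = moebius_mat P \<alpha> \<beta> ** moebius_mat P \<beta> \<gamma>"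
proof -
  have "fst (pchart P \<alpha>) \<inter> fst (pchart P \<beta>) \<inter> fst (pchart P \<gamma>) \<noteq> {}"
    using assms(4) by auto
  moreover have "\<forall>\<alpha>\<in>index P. \<forall>\<beta>\<in>index P. \<forall>\<gamma>\<in>index P.
        fst (pchart P \<alpha>) \<inter> fst (pchart P \<beta>) \<inter> fst (pchart P \<gamma>) \<noteq> {} \<longrightarrow>
        moebius_mat P \<alpha> \<gamma> = moebius_mat P \<alpha> \<beta> ** moebius_mat P \<beta> \<gamma>"
    using P unfolding projective_coordinate_system_def by (elim conjE)
  ultimately show ?thesis using assms(1-3) by blast
qed

lemma \<kappa>_sq:
  assumes "\<alpha> \<in> index P" "\<beta> \<in> index P" "p \<in> fst (pchart P \<alpha>) \<inter> fst (pchart P \<beta>)"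
  shows "\<kappa> \<alpha> \<beta> p \<noteq> 0" "chart_deriv (pchart P \<alpha>) (snd (pchart P \<beta>)) p = (\<kappa> \<alpha> \<beta> p)\<^sup>2"
  using conjunct1[OF \<kappa>[unfolded theta_characteristic_def]] assms by simp_all

lemma \<kappa>_cocycle:
  assumes "\<alpha> \<in> index P" "\<beta> \<in> index P" "\<gamma> \<in> index P"
    and "p \<in> fst (pchart P \<alpha>) \<inter> fst (pchart P \<beta>) \<inter> fst (pchart P \<gamma>)"
  shows "\<kappa> \<alpha> \<gamma> p = \<kappa> \<alpha> \<beta> p * \<kappa> \<beta> \<gamma> p"
  using conjunct2[OF \<kappa>[unfolded theta_characteristic_def], rule_format, OF assms] .

lemma scalar_op_oper_module:
  assumes "\<alpha> \<in> index P" "p \<in> fst (pchart P \<alpha>)" "h \<noteq> 0"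
    and \<psi>: "chart_hol (pchart P \<alpha>) (fst (pchart P \<alpha>)) \<psi>"
  shows "scalar_op P (oper_module P \<kappa> q) h \<alpha> \<psi> p =
      h\<^sup>2 * chart_deriv (pchart P \<alpha>) (chart_deriv (pchart P \<alpha>) \<psi>) p - q (pchart P \<alpha>) p * \<psi> p"
proof -
  let ?c = "pchart P \<alpha>"
  have c: "is_chart (points C) ?c" and o: "openin (points C) (fst ?c)"
    using atlas_chart pchart_atlas assms by (auto simp: is_chart_def)
  have "chart_deriv ?c (\<lambda>p. jet P h \<alpha> \<psi> p $ 1) p = h * chart_deriv ?c (chart_deriv ?c \<psi>) p"
  proof (rule chart_deriv_eqI[OF c o order_refl])
    show "((\<lambda>z. h * (chart_deriv ?c \<psi> \<circ> chart_inv ?c) z) has_field_derivative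
        h * chart_deriv ?c (chart_deriv ?c \<psi>) p) (at (snd ?c p))"
      by (rule DERIV_cmult, rule chart_has_deriv[OF c o order_refl chart_hol_deriv[OF c o order_refl \<psi>]])
        (rule assms(2))
  qed (use assms chart_inv_left[OF c] in \<open>auto simp: jet_def\<close>)
  then show ?thesis
    using \<open>h \<noteq> 0\<close> by (simp add: scalar_op_def oper_row1) (simp add: jet_def power2_eq_square)
qed

lemma flat_iff_scalar_op:
  assumes "h \<noteq> 0"
  shows "(\<forall>p\<in>W. hop (oper_module P \<kappa> q) h \<alpha> s p = 0) \<longleftrightarrow>
      (\<forall>p\<in>W. hop (oper_module P \<kappa> q) h \<alpha> s p $ 1 = 0 \<and> s p = jet P h \<alpha> (\<lambda>p. s p $ 2) p)"
  using assms by (auto simp: vec_eq_iff forall_2 oper_row2 jet_def)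

lemma flat_jet_iff:
  assumes "h \<noteq> 0"
  shows "hop (oper_module P \<kappa> q) h \<alpha> (jet P h \<alpha> \<psi>) p = 0 \<longleftrightarrow>
    scalar_op P (oper_module P \<kappa> q) h \<alpha> \<psi> p = 0"
  using assms by (auto simp: vec_eq_iff forall_2 oper_row2 scalar_op_def) (simp add: jet_def)

lemma deriv_kappa:
  assumes "\<alpha> \<in> index P" "\<beta> \<in> index P" "p \<in> fst (pchart P \<alpha>) \<inter> fst (pchart P \<beta>)"
  shows "chart_deriv (pchart P \<beta>) (\<kappa> \<alpha> \<beta>) p = moebius_mat P \<alpha> \<beta> $ 2 $ 1"
proof (rule chart_deriv_eqI)
  show "openin (points C) (fst (pchart P \<alpha>) \<inter> fst (pchart P \<beta>))"
    using atlas_chart[OF pchart_atlas[OF assms(1)]] atlas_chart[OF pchart_atlas[OF assms(2)]] by (auto simp: is_chart_def)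
  show "((\<lambda>z. moebius_mat P \<alpha> \<beta> $ 2 $ 1 * z + moebius_mat P \<alpha> \<beta> $ 2 $ 2) has_field_derivative
      moebius_mat P \<alpha> \<beta> $ 2 $ 1) (at (snd (pchart P \<beta>) p))"
    by (auto intro!: derivative_eq_intros)
qed (use assms pchart_atlas atlas_chart xi in \<open>auto simp: xi_def\<close>)

lemma deriv_coords:
  assumes "\<alpha> \<in> index P" "\<beta> \<in> index P" "p \<in> fst (pchart P \<alpha>) \<inter> fst (pchart P \<beta>)"
  shows "chart_deriv (pchart P \<beta>) (snd (pchart P \<alpha>)) p = 1 / (\<kappa> \<alpha> \<beta> p)\<^sup>2"
proof -
  let ?a = "pchart P \<alpha>" and ?b = "pchart P \<beta>"
  have a: "is_chart (points C) ?a" and b: "is_chart (points C) ?b"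
    using assms pchart_atlas atlas_chart by auto
  have o: "openin (points C) (fst ?a \<inter> fst ?b)"
    using a b by (auto simp: is_chart_def)
  have ab: "charts_compatible ?a ?b"
    using assms pchart_atlas C by (auto simp: riemann_surface_def)
  have "chart_deriv ?b (snd ?b) p = chart_deriv ?a (snd ?b) p * chart_deriv ?b (snd ?a) p"
    by (rule chart_deriv_chain[OF a b ab o]) (use ab assms in \<open>auto simp: charts_compatible_def\<close>)
  moreover have "chart_deriv ?b (snd ?b) p = 1"
    by (rule chart_deriv_eqI[OF b o, where G = "\<lambda>z. z"]) (use assms in auto)
  moreover have "chart_deriv ?a (snd ?b) p = (\<kappa> \<alpha> \<beta> p)\<^sup>2" "\<kappa> \<alpha> \<beta> p \<noteq> 0"
    using \<kappa>_sq assms by auto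
  ultimately show ?thesis
    by (simp add: field_simps)
qed

lemma phi_glue:
  assumes "\<alpha> \<in> index P" "\<beta> \<in> index P" and p: "p \<in> fst (pchart P \<alpha>) \<inter> fst (pchart P \<beta>)"
  shows "phi P q \<alpha> p ** E_0 \<kappa> \<alpha> \<beta> p =
    mat (chart_deriv (pchart P \<alpha>) (snd (pchart P \<beta>)) p) ** (E_0 \<kappa> \<alpha> \<beta> p ** phi P q \<beta> p)"
proof -
  have "q (pchart P \<beta>) p = q (pchart P \<alpha>) p * chart_deriv (pchart P \<beta>) (snd (pchart P \<alpha>)) p ^ 2"
    using q pchart_atlas[OF assms(1)] pchart_atlas[OF assms(2)] p unfolding H0_K_def by blast
  then show ?thesis
    using \<kappa>_sq[OF assms] deriv_coords[OF assms]
    by (simp add: vec_eq_iff forall_2 matrix_matrix_mult_def sum_2 phi_def E_0_def mat_def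
        field_simps power2_eq_square)
qed

lemma E_hbar_0: "E_hbar P \<kappa> 0 = E_0 \<kappa>"
  by (simp add: E_hbar_def E_0_def fun_eq_iff)

lemma E_hbar_cocycle:
  assumes "\<alpha> \<in> index P" "\<beta> \<in> index P" "\<gamma> \<in> index P"
    and p: "p \<in> fst (pchart P \<alpha>) \<inter> fst (pchart P \<beta>) \<inter> fst (pchart P \<gamma>)"
  shows "E_hbar P \<kappa> h \<alpha> \<gamma> p = E_hbar P \<kappa> h \<alpha> \<beta> p ** E_hbar P \<kappa> h \<beta> \<gamma> p"
proof -
  let ?A = "moebius_mat P \<alpha> \<beta>" and ?B = "moebius_mat P \<beta> \<gamma>"
  define w z k where "w = snd (pchart P \<beta>) p" and "z = snd (pchart P \<gamma>) p" and "k = xi P \<beta> \<gamma> p"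
  have M: "moebius_mat P \<alpha> \<gamma> = ?A ** ?B"
    using moebius_mat_cocycle[OF assms] .
  have k0: "k \<noteq> 0" and B: "det ?B = 1" and w: "w = (?B $ 1 $ 1 * z + ?B $ 1 $ 2) / k"
    and kz: "k = ?B $ 2 $ 1 * z + ?B $ 2 $ 2"
    using moebius_mat_props[OF assms(2,3)] \<kappa>_sq[OF assms(2,3)] xi[OF assms(2,3)] p
    by (simp_all add: w_def z_def k_def xi_def)
  have wk: "w * k = ?B $ 1 $ 1 * z + ?B $ 1 $ 2"
    using w k0 by simp
  have "w * ?B $ 2 $ 1 * k + 1 = (w * k) * ?B $ 2 $ 1 + 1"
    by (simp add: algebra_simps)
  also have "\<dots> = ?B $ 1 $ 1 * k"
    unfolding wk using B unfolding det_2 by (simp add: kz algebra_simps)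
  finally have "w * ?B $ 2 $ 1 * k + 1 = ?B $ 1 $ 1 * k" .
  then have "w * ?B $ 2 $ 1 + 1 / k = ?B $ 1 $ 1"
    using k0 by (simp add: field_simps)
  then have "?A $ 2 $ 1 * ?B $ 1 $ 1 = ?A $ 2 $ 1 * (w * ?B $ 2 $ 1 + 1 / k)"
    by simp
  then have c: "moebius_mat P \<alpha> \<gamma> $ 2 $ 1 = xi P \<alpha> \<beta> p * ?B $ 2 $ 1 + ?A $ 2 $ 1 * inverse k"
    by (simp add: M matrix_matrix_mult_def sum_2 xi_def w_def[symmetric] algebra_simps divide_inverse)
  have "\<kappa> \<alpha> \<gamma> p = \<kappa> \<alpha> \<beta> p * \<kappa> \<beta> \<gamma> p"
    using \<kappa>_cocycle[OF assms] .
  then show ?thesis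
    using assms c
    by (simp add: vec_eq_iff forall_2 matrix_matrix_mult_def sum_2 E_hbar_def deriv_kappa xi k_def algebra_simps)
qed

lemma oper_module_glue:
  assumes i: "\<alpha> \<in> index P" "\<beta> \<in> index P" and "h \<noteq> 0"
    and W: "openin (points C) W" "W \<subseteq> fst (pchart P \<alpha>) \<inter> fst (pchart P \<beta>)" "p \<in> W"
    and s: "\<And>i. chart_hol (pchart P \<beta>) W (\<lambda>p. s p $ i)"
  shows "chart_deriv (pchart P \<beta>) (snd (pchart P \<alpha>)) p *s
      hop (oper_module P \<kappa> q) h \<alpha> (\<lambda>p. E_hbar P \<kappa> h \<alpha> \<beta> p *v s p) p =
    E_hbar P \<kappa> h \<alpha> \<beta> p *v hop (oper_module P \<kappa> q) h \<beta> s p"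
proof -
  let ?a = "pchart P \<alpha>" and ?b = "pchart P \<beta>"
  define m d where "m = moebius_mat P \<alpha> \<beta> $ 2 $ 1" and "d = moebius_mat P \<alpha> \<beta> $ 2 $ 2"
  define S where "S i = (\<lambda>p. s p $ i) \<circ> chart_inv ?b" for i
  define D where "D i = chart_deriv ?b (\<lambda>p. s p $ i) p" for i
  define k where "k = \<kappa> \<alpha> \<beta> p"
  define f where "f i = (\<lambda>p. (E_hbar P \<kappa> h \<alpha> \<beta> p *v s p) $ i)" for i
  have a: "is_chart (points C) ?a" and b: "is_chart (points C) ?b"
    using i pchart_atlas atlas_chart by auto
  have ab: "charts_compatible ?a ?b"
    using i pchart_atlas C by (auto simp: riemann_surface_def)
  have \<kappa>W: "\<kappa> \<alpha> \<beta> p' = m * snd ?b p' + d" "\<kappa> \<alpha> \<beta> p' \<noteq> 0" if "p' \<in> W" for p'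
  proof -
    have p': "p' \<in> fst ?a \<inter> fst ?b" using that W by auto
    show "\<kappa> \<alpha> \<beta> p' = m * snd ?b p' + d" "\<kappa> \<alpha> \<beta> p' \<noteq> 0"
      using xi[OF i p'] \<kappa>_sq[OF i p'] by (simp_all add: xi_def m_def d_def)
  qed
  have k: "k = m * snd ?b p + d" "k \<noteq> 0"
    using \<kappa>W[OF W(3)] by (auto simp: k_def)
  have S: "(S i has_field_derivative D i) (at (snd ?b p))" for i
    unfolding S_def D_def by (rule chart_has_deriv[OF b W(1) _ s]) (use W in auto)
  have SW: "S i (snd ?b p') = s p' $ i" if "p' \<in> W" for i p'
    using chart_inv_left[OF b, of p'] that W by (auto simp: S_def)
  have f1: "f 1 p' = (m * snd ?b p' + d) * S 1 (snd ?b p') - h * m * S 2 (snd ?b p')" 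
   and f2: "f 2 p' = S 2 (snd ?b p') / (m * snd ?b p' + d)" if "p' \<in> W" for p'
    using that W i by (auto simp: f_def E_hbar_def matrix_vector_mult_def sum_2 SW \<kappa>W deriv_kappa
        m_def[symmetric] subset_iff divide_inverse)
  have d1: "chart_deriv ?b (f 1) p = m * s p $ 1 + k * D 1 - h * m * D 2"
    by (rule chart_deriv_eqI[OF b W(1) _ W(3), where G = "\<lambda>z. (m * z + d) * S 1 z - h * m * S 2 z"])
      (use W S k SW f1 in \<open>auto intro!: derivative_eq_intros\<close>)
  have "((\<lambda>z. m * z + d) has_field_derivative m) (at (snd ?b p))"
    by (auto intro!: derivative_eq_intros)
  then have "((\<lambda>z. S 2 z / (m * z + d)) has_field_derivative (D 2 * k - s p $ 2 * m) / (k * k)) (at (snd ?b p))"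
    using DERIV_divide[OF S[of 2]] k SW[OF W(3), of 2] by fastforce
  then have "chart_deriv ?b (f 2) p = (D 2 * k - s p $ 2 * m) / (k * k)"
    using W f2 by (intro chart_deriv_eqI[OF b W(1) _ W(3)]) auto
  then have d2: "chart_deriv ?b (f 2) p = D 2 / k - m * s p $ 2 / k\<^sup>2"
    using k(2) by (simp add: field_simps power2_eq_square)
  have z: "chart_deriv ?b (snd ?a) p = 1 / k\<^sup>2"
    unfolding k_def using deriv_coords[OF i] W by blast
  have Sh: "S i holomorphic_on snd ?b ` W" for i
    using s unfolding S_def chart_hol_def .
  have inv: "chart_inv ?b (snd ?b p') = p'" if "p' \<in> W" for p'
    using chart_inv_left[OF b, of p'] that W by auto
  have "(\<lambda>z. (m * z + d) * S 1 z - h * m * S 2 z) holomorphic_on snd ?b ` W"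
    by (intro holomorphic_intros Sh)
  then have "chart_hol ?b W (f 1)"
    unfolding chart_hol_def by (rule holomorphic_transform) (auto simp: f1 inv)
  moreover have "(\<lambda>z. S 2 z / (m * z + d)) holomorphic_on snd ?b ` W"
    by (intro holomorphic_intros Sh) (use \<kappa>W in auto)
  then have "chart_hol ?b W (f 2)"
    unfolding chart_hol_def by (rule holomorphic_transform) (auto simp: f2 inv)
  ultimately have hol: "chart_hol ?a W (f i)" for i
    using chart_hol_transfer[OF a b ab W(2)] exhaust_2[of i] by metis
  have ch: "chart_deriv ?b (f i) p = chart_deriv ?a (f i) p / k\<^sup>2" for i
    using chart_deriv_chain[OF a b ab W hol] z by simp
  have q: "q ?b p = q ?a p / k ^ 4"
  proof -
    have "q ?b p = q ?a p * chart_deriv ?b (snd ?a) p ^ 2"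
      using q pchart_atlas[OF i(1)] pchart_atlas[OF i(2)] W unfolding H0_K_def by blast
    then show ?thesis using z by (simp add: power_divide flip: power_mult)
  qed
  have f: "f 1 p = k * s p $ 1 - h * m * s p $ 2" "f 2 p = s p $ 2 / k"
    using f1 f2 W k SW by auto
  have e1: "1 / k\<^sup>2 * (h * chart_deriv ?a (f 1) p - q ?a p * f 2 p) =
      k * (h * D 1 - q ?b p * s p $ 2) - h * m * (h * D 2 - s p $ 1)"
  proof -
    have "1 / k\<^sup>2 * (h * chart_deriv ?a (f 1) p - q ?a p * f 2 p) =
       h * (chart_deriv ?a (f 1) p / k\<^sup>2) - q ?a p * f 2 p / k\<^sup>2"
      by (simp add: right_diff_distrib)
    also have "\<dots> = h * (m * s p $ 1 + k * D 1 - h * m * D 2) - q ?a p * s p $ 2 / k ^ 3"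
      using ch[of 1] d1 f k by (simp add: power2_eq_square power3_eq_cube)
    also have "\<dots> = k * (h * D 1 - q ?b p * s p $ 2) - h * m * (h * D 2 - s p $ 1)"
      using k(2) unfolding q by (simp add: field_simps power2_eq_square power3_eq_cube power4_eq_xxxx)
    finally show ?thesis .
  qed
  have e2: "1 / k\<^sup>2 * (h * chart_deriv ?a (f 2) p - f 1 p) = (h * D 2 - s p $ 1) / k"
  proof -
    have "1 / k\<^sup>2 * (h * chart_deriv ?a (f 2) p - f 1 p) = h * (chart_deriv ?a (f 2) p / k\<^sup>2) - f 1 p / k\<^sup>2"
      by (simp add: right_diff_distrib diff_divide_distrib)
    also have "\<dots> = (h * D 2 - s p $ 1) / k"
      unfolding ch[of 2, symmetric] d2 f using k(2) by (simp add: field_simps power2_eq_square)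
    finally show ?thesis .
  qed
  have g: "E_hbar P \<kappa> h \<alpha> \<beta> p = vector [vector [k, - h * m], vector [0, inverse k]]"
    using i W by (auto simp: E_hbar_def k_def deriv_kappa m_def subset_iff)
  have L: "hop (oper_module P \<kappa> q) h \<alpha> (\<lambda>p. E_hbar P \<kappa> h \<alpha> \<beta> p *v s p) p $ 1 =
        h * chart_deriv ?a (f 1) p - q ?a p * f 2 p"
      "hop (oper_module P \<kappa> q) h \<alpha> (\<lambda>p. E_hbar P \<kappa> h \<alpha> \<beta> p *v s p) p $ 2 =
        h * chart_deriv ?a (f 2) p - f 1 p"
      "hop (oper_module P \<kappa> q) h \<beta> s p $ 1 = h * D 1 - q ?b p * s p $ 2"
      "hop (oper_module P \<kappa> q) h \<beta> s p $ 2 = h * D 2 - s p $ 1"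
    using \<open>h \<noteq> 0\<close> by (simp_all add: oper_row1 oper_row2 f_def D_def)
  have gv: "(E_hbar P \<kappa> h \<alpha> \<beta> p *v v) $ 1 = k * v $ 1 - h * m * v $ 2"
    "(E_hbar P \<kappa> h \<alpha> \<beta> p *v v) $ 2 = v $ 2 / k" for v
    by (simp_all add: g matrix_vector_mult_def sum_2 divide_inverse)
  show ?thesis
    unfolding vec_eq_iff forall_2 z gv vector_smult_component L using e1 e2 by simp
qed

end

end

theory Submission
  imports Defs
begin

text \<open>Conjugating \<open>\<hbar>\<^sup>2(d/dz)\<^sup>2 - q\<close> by \<open>exp(S\<^sub>0/\<hbar>)\<close> gives the function \<open>(S\<^sub>0')\<^sup>2 + \<hbar> S\<^sub>0'' - q\<close>,
  whose limit \<open>y\<^sup>2 - q\<close> is the characteristic polynomial \<open>det(y - \<phi>(q))\<close>. Under a change of chart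
  \<open>y\<^sup>2 - q\<close> is multiplied by the unit \<open>(dz\<^sub>\<alpha>/dz\<^sub>\<beta>)\<^sup>2\<close>, so these functions are local equations of one
  divisor; and an effective divisor is determined by local equations over a cover.\<close>

section \<open>Charts of the cotangent bundle\<close>

context
  fixes C :: "'p surface"
  assumes C: "riemann_surface C"
begin

lemma is_chart_atlas: "c \<in> atlas C \<Longrightarrow> is_chart (points C) c"
  using C by (auto simp: riemann_surface_def)

lemma compatible_atlas: "c \<in> atlas C \<Longrightarrow> d \<in> atlas C \<Longrightarrow> charts_compatible c d"
  using C by (auto simp: riemann_surface_def)

lemma openin_atlas: "c \<in> atlas C \<Longrightarrow> openin (points C) (fst c)"
  using is_chart_atlas by (auto simp: is_chart_def)

lemma chart_deriv_self:
  assumes "c \<in> atlas C" "p \<in> fst c"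
  shows "chart_deriv c (snd c) p = 1"
  by (rule chart_deriv_eqI[OF is_chart_atlas openin_atlas, where G = "\<lambda>z. z"]) (use assms in auto)

text \<open>The cocycle rule on triple overlaps. It is what lets a single component propagate
  consistently to all charts in \<open>Tcoord_onto\<close>.\<close>

lemma chart_deriv_trans:
  assumes "c \<in> atlas C" "d \<in> atlas C" "e \<in> atlas C" "p \<in> fst c \<inter> fst d \<inter> fst e"
  shows "chart_deriv e (snd c) p = chart_deriv d (snd c) p * chart_deriv e (snd d) p"
proof (rule chart_deriv_chain[OF is_chart_atlas is_chart_atlas compatible_atlas])
  show "openin (points C) (fst c \<inter> fst d \<inter> fst e)"
    using assms openin_atlas by (intro openin_Int) auto
  have "chart_hol d (fst c \<inter> fst d) (snd c)"
    using compatible_atlas[of c d] assms by (auto simp: charts_compatible_def)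
  then show "chart_hol d (fst c \<inter> fst d \<inter> fst e) (snd c)"
    unfolding chart_hol_def by (rule holomorphic_on_subset) auto
qed (use assms in auto)

text \<open>Going from \<open>c\<close> to \<open>d\<close> and back, the cocycle rule writes 1 as a
  product containing this factor. The nonvanishing is what later makes the change of local equation
  a unit.\<close>

lemma chart_deriv_transition_nonzero:
  assumes "c \<in> atlas C" "d \<in> atlas C" "p \<in> fst c \<inter> fst d"
  shows "chart_deriv d (snd c) p \<noteq> 0"
  using chart_deriv_trans[of c d c p] chart_deriv_self[of c p] assms by auto

lemma chart_hol_transition_deriv:
  assumes "c \<in> atlas C" "d \<in> atlas C"
  shows "chart_hol d (fst c \<inter> fst d) (chart_deriv d (snd c))"
  using assms openin_Int[OF openin_atlas openin_atlas, of c d] compatible_atlas[of c d]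
  by (intro chart_hol_deriv[OF is_chart_atlas]) (simp_all add: charts_compatible_def)

section \<open>Covectors and their coordinates\<close>

lemma Tstar_fst: "x \<in> Tstar C \<Longrightarrow> fst x \<in> topspace (points C)"
  unfolding Tstar_def case_prod_unfold by blast

lemma taut_outside: "x \<in> Tstar C \<Longrightarrow> \<not> (c \<in> atlas C \<and> fst x \<in> fst c) \<Longrightarrow> taut c x = 0"
  unfolding Tstar_def taut_def case_prod_unfold by blast

lemma taut_transition:
  assumes "x \<in> Tover C c \<inter> Tover C d" "c \<in> atlas C" "d \<in> atlas C"
  shows "taut d x = taut c x * chart_deriv d (snd c) (fst x)"
  using assms unfolding Tover_def Tstar_def taut_def case_prod_unfold by blast

text \<open>The base point is recovered because a chart is injective on its domain. The component in
  \<open>c\<close> then forces the components in all other charts at that point, and the remaining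
  ones are normalised to 0, so no freedom is left.\<close>

lemma inj_on_Tcoord:
  assumes c: "c \<in> atlas C"
  shows "inj_on (Tcoord c) (Tover C c)"
proof (rule inj_onI)
  fix x x' assume x: "x \<in> Tover C c" "x' \<in> Tover C c" and eq: "Tcoord c x = Tcoord c x'"
  have p: "fst x = fst x'"
    using eq x chart_inj[OF is_chart_atlas[OF c]] by (auto simp: Tcoord_def Tover_def dest: inj_onD)
  have "snd x d = snd x' d" for d
  proof (cases "d \<in> atlas C \<and> fst x \<in> fst d")
    case True
    then have "x \<in> Tover C c \<inter> Tover C d" "x' \<in> Tover C c \<inter> Tover C d"
      using x p by (auto simp: Tover_def)
    then show ?thesis
      using taut_transition[of x c d] taut_transition[of x' c d] c True eq p
      by (simp add: taut_def Tcoord_def)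
  next
    case False
    then show ?thesis
      using x p taut_outside[of x d] taut_outside[of x' d] by (simp add: Tover_def taut_def)
  qed
  then show "x = x'"
    using p by (simp add: prod_eq_iff fun_eq_iff)
qed

lemma Tcoord_onto:
  assumes c: "c \<in> atlas C" and p: "p \<in> fst c"
  obtains x where "x \<in> Tover C c" "fst x = p" "taut c x = w"
proof -
  \<comment> \<open>The value \<open>w\<close> is transported from \<open>c\<close> by the
    transition factor. The cocycle rule gives compatibility between any two charts, and the default
    0 matches the normalisation in \<open>Tstar\<close>.\<close>
  define y where "y d = (if d \<in> atlas C \<and> p \<in> fst d then w * chart_deriv d (snd c) p else 0)" for d
  have "p \<in> topspace (points C)"
    using openin_atlas[OF c] p openin_subset by blast
  moreover have "y e = y d * chart_deriv e (snd d) p"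
    if "d \<in> atlas C" "e \<in> atlas C" "p \<in> fst d \<inter> fst e" for d e
    using that c p chart_deriv_trans[of c d e p] by (simp add: y_def)
  ultimately have "(p, y) \<in> Tover C c"
    using p by (auto simp: Tover_def Tstar_def y_def)
  moreover have "y c = w"
    using c p by (simp add: y_def chart_deriv_self)
  ultimately show ?thesis
    using that[of "(p, y)"] by (simp add: taut_def)
qed

text \<open>The bundle is trivial over a chart, since \<open>Tcoord_onto\<close> attains every fibre
  value. Openness of preimages of base sets thus reduces to openness in the plane.\<close>

lemma Tcoord_image:
  assumes c: "c \<in> atlas C"
  shows "Tcoord c ` {x \<in> Tover C c. fst x \<in> W} = (snd c ` (W \<inter> fst c)) \<times> UNIV"
proof
  show "Tcoord c ` {x \<in> Tover C c. fst x \<in> W} \<subseteq> (snd c ` (W \<inter> fst c)) \<times> UNIV"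
    by (auto simp: Tcoord_def Tover_def)
  show "(snd c ` (W \<inter> fst c)) \<times> UNIV \<subseteq> Tcoord c ` {x \<in> Tover C c. fst x \<in> W}"
  proof clarify
    fix p w assume p: "p \<in> W" "p \<in> fst c"
    obtain x where "x \<in> Tover C c" "fst x = p" "taut c x = w"
      using Tcoord_onto[OF c p(2)] .
    then show "(snd c p, w) \<in> Tcoord c ` {x \<in> Tover C c. fst x \<in> W}"
      using p by (intro image_eqI[of _ _ x]) (auto simp: Tcoord_def)
  qed
qed

section \<open>Open sets of the cotangent bundle\<close>

lemma Topen_preimage:
  assumes "openin (points C) W"
  shows "Topen C {x \<in> Tstar C. fst x \<in> W}"
proof -
  have "open (Tcoord c ` ({x \<in> Tstar C. fst x \<in> W} \<inter> Tover C c))" if c: "c \<in> atlas C" for c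
  proof -
    have "{x \<in> Tstar C. fst x \<in> W} \<inter> Tover C c = {x \<in> Tover C c. fst x \<in> W}"
      by (auto simp: Tover_def)
    moreover have "open (snd c ` (W \<inter> fst c))"
      using assms openin_atlas[OF c] by (intro open_chart_image[OF is_chart_atlas[OF c]]) auto
    ultimately show ?thesis
      by (simp add: Tcoord_image[OF c] open_Times)
  qed
  then show ?thesis
    by (auto simp: Topen_def)
qed

lemma Topen_Tover: "c \<in> atlas C \<Longrightarrow> Topen C (Tover C c)"
  using Topen_preimage[OF openin_atlas] by (simp add: Tover_def)

text \<open>Openness is tested on images under \<open>Tcoord c\<close>, and these commute with
  intersections by injectivity.\<close>

lemma Topen_Int:
  assumes "Topen C V" "Topen C W"
  shows "Topen C (V \<inter> W)"
proof -
  have "open (Tcoord c ` (V \<inter> W \<inter> Tover C c))" if c: "c \<in> atlas C" for c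
  proof -
    have "Tcoord c ` ((V \<inter> Tover C c) \<inter> (W \<inter> Tover C c)) =
        Tcoord c ` (V \<inter> Tover C c) \<inter> Tcoord c ` (W \<inter> Tover C c)"
      by (rule inj_on_image_Int[OF inj_on_Tcoord[OF c]]) auto
    moreover have "(V \<inter> Tover C c) \<inter> (W \<inter> Tover C c) = V \<inter> W \<inter> Tover C c"
      by blast
    ultimately show ?thesis
      using assms c by (auto simp: Topen_def)
  qed
  then show ?thesis
    using assms by (auto simp: Topen_def)
qed

section \<open>Holomorphic functions on the cotangent bundle\<close>

text \<open>Frees holomorphy from \<open>inv_into\<close>: any coordinate expression
  \<open>G\<close> will do, because a derivative depends only on values in a neighbourhood and the
  coordinate image of \<open>W\<close> is open.\<close>

lemma Thol_iff:
  assumes "Topen C W"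
  shows "Thol C W f \<longleftrightarrow> (\<forall>c\<in>atlas C. \<exists>G. holomorphic2_on G (Tcoord c ` (W \<inter> Tover C c)) \<and>
    (\<forall>x\<in>W \<inter> Tover C c. f x = G (Tcoord c x)))"
proof -
  let ?i = "\<lambda>c. inv_into (Tover C c) (Tcoord c)"
  have inv: "?i c (Tcoord c x) = x" if "c \<in> atlas C" "x \<in> Tover C c" for c x
    using inv_into_f_f[OF inj_on_Tcoord] that .
  have "holomorphic2_on (f \<circ> ?i c) (Tcoord c ` (W \<inter> Tover C c))"
    if c: "c \<in> atlas C" and G: "holomorphic2_on G (Tcoord c ` (W \<inter> Tover C c))"
      "\<forall>x\<in>W \<inter> Tover C c. f x = G (Tcoord c x)" for c G
    unfolding holomorphic2_on_def
  proof
    fix v assume v: "v \<in> Tcoord c ` (W \<inter> Tover C c)"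
    then obtain a b where ab: "(G has_derivative (\<lambda>h. a * fst h + b * snd h)) (at v)"
      using G(1) unfolding holomorphic2_on_def by blast
    have "(f \<circ> ?i c has_derivative (\<lambda>h. a * fst h + b * snd h)) (at v)"
    proof (rule has_derivative_transform_within_open[OF ab _ v])
      show "open (Tcoord c ` (W \<inter> Tover C c))"
        using assms c by (simp add: Topen_def)
      show "G v' = (f \<circ> ?i c) v'" if "v' \<in> Tcoord c ` (W \<inter> Tover C c)" for v'
        using that G(2) inv[OF c] by fastforce
    qed
    then show "\<exists>a b. (f \<circ> ?i c has_derivative (\<lambda>h. a * fst h + b * snd h)) (at v)"
      by blast
  qed
  moreover have "\<forall>x\<in>W \<inter> Tover C c. f x = (f \<circ> ?i c) (Tcoord c x)" if "c \<in> atlas C" for c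
    using inv that by simp
  ultimately show ?thesis
    unfolding Thol_def by blast
qed

lemma Thol_cong:
  assumes "Topen C W" "\<And>x. x \<in> W \<Longrightarrow> f x = g x"
  shows "Thol C W f \<longleftrightarrow> Thol C W g"
  using assms by (simp add: Thol_iff)

text \<open>\<open>V\<close> may be arbitrary, because \<open>holomorphic2_on\<close> asks at each
  point for an unrestricted derivative, not one relative to the set.\<close>

lemma Thol_subset: "Thol C W f \<Longrightarrow> V \<subseteq> W \<Longrightarrow> Thol C V f"
  unfolding Thol_def holomorphic2_on_def by blast

section \<open>Algebra and composition of holomorphic functions\<close>

lemma holomorphic2_on_mult:
  assumes "holomorphic2_on f S" "holomorphic2_on g S"
  shows "holomorphic2_on (\<lambda>v. f v * g v) S"
  unfolding holomorphic2_on_def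
proof
  fix v assume "v \<in> S"
  then obtain a b a' b' where "(f has_derivative (\<lambda>h. a * fst h + b * snd h)) (at v)"
      "(g has_derivative (\<lambda>h. a' * fst h + b' * snd h)) (at v)"
    using assms unfolding holomorphic2_on_def by blast
  then have "((\<lambda>v. f v * g v) has_derivative
      (\<lambda>h. (f v * a' + a * g v) * fst h + (f v * b' + b * g v) * snd h)) (at v)"
    by (rule has_derivative_eq_rhs[OF has_derivative_mult]) (simp add: fun_eq_iff algebra_simps)
  then show "\<exists>a b. ((\<lambda>v. f v * g v) has_derivative (\<lambda>h. a * fst h + b * snd h)) (at v)"
    by blast
qed

lemma holomorphic2_on_diff:
  assumes "holomorphic2_on f S" "holomorphic2_on g S"
  shows "holomorphic2_on (\<lambda>v. f v - g v) S"
  unfolding holomorphic2_on_def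
proof
  fix v assume "v \<in> S"
  then obtain a b a' b' where "(f has_derivative (\<lambda>h. a * fst h + b * snd h)) (at v)"
      "(g has_derivative (\<lambda>h. a' * fst h + b' * snd h)) (at v)"
    using assms unfolding holomorphic2_on_def by blast
  then have "((\<lambda>v. f v - g v) has_derivative (\<lambda>h. (a - a') * fst h + (b - b') * snd h)) (at v)"
    by (rule has_derivative_eq_rhs[OF has_derivative_diff]) (simp add: fun_eq_iff algebra_simps)
  then show "\<exists>a b. ((\<lambda>v. f v - g v) has_derivative (\<lambda>h. a * fst h + b * snd h)) (at v)"
    by blast
qed

text \<open>By the chain rule the outer complex derivative only scales the complex linear inner one.
  The lemma serves \<open>inverse\<close>, for units, and functions of the base point, with
  \<open>fst\<close> as inner function.\<close>

lemma holomorphic2_on_compose: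
  assumes g: "g holomorphic_on T" "open T" and f: "holomorphic2_on f S" "f ` S \<subseteq> T"
  shows "holomorphic2_on (\<lambda>v. g (f v)) S"
  unfolding holomorphic2_on_def
proof
  fix v assume v: "v \<in> S"
  then obtain a b where ab: "(f has_derivative (\<lambda>h. a * fst h + b * snd h)) (at v)"
    using f(1) unfolding holomorphic2_on_def by blast
  have "(g has_derivative (*) (deriv g (f v))) (at (f v))"
    using g f v holomorphic_derivI[OF g] by (auto simp: has_field_derivative_def)
  with ab have "((\<lambda>v. g (f v)) has_derivative
      (\<lambda>h. (deriv g (f v) * a) * fst h + (deriv g (f v) * b) * snd h)) (at v)"
    by (rule has_derivative_eq_rhs[OF has_derivative_compose]) (simp add: fun_eq_iff algebra_simps)
  then show "\<exists>a b. ((\<lambda>v. g (f v)) has_derivative (\<lambda>h. a * fst h + b * snd h)) (at v)"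
    by blast
qed

lemma holomorphic2_on_fst: "holomorphic2_on fst S"
  unfolding holomorphic2_on_def
  by (intro ballI exI[of _ 1] exI[of _ 0]) (auto intro!: derivative_eq_intros)

lemma holomorphic2_on_snd: "holomorphic2_on snd S"
  unfolding holomorphic2_on_def
  by (intro ballI exI[of _ 0] exI[of _ 1]) (auto intro!: derivative_eq_intros)

lemma Thol_mult: "Thol C W f \<Longrightarrow> Thol C W g \<Longrightarrow> Thol C W (\<lambda>x. f x * g x)"
  unfolding Thol_def o_def by (auto intro!: holomorphic2_on_mult)

lemma Thol_diff: "Thol C W f \<Longrightarrow> Thol C W g \<Longrightarrow> Thol C W (\<lambda>x. f x - g x)"
  unfolding Thol_def o_def by (auto intro!: holomorphic2_on_diff)

lemma Thol_inverse:
  assumes "Thol C W f" "\<And>x. x \<in> W \<Longrightarrow> f x \<noteq> 0"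
  shows "Thol C W (\<lambda>x. inverse (f x))"
  unfolding Thol_def o_def
proof
  fix c assume c: "c \<in> atlas C"
  show "holomorphic2_on (\<lambda>v. inverse (f (inv_into (Tover C c) (Tcoord c) v)))
      (Tcoord c ` (W \<inter> Tover C c))"
  proof (rule holomorphic2_on_compose[of inverse "- {0}"])
    show "holomorphic2_on (\<lambda>v. f (inv_into (Tover C c) (Tcoord c) v)) (Tcoord c ` (W \<inter> Tover C c))"
      using assms(1) c by (simp add: Thol_def o_def)
    show "(\<lambda>v. f (inv_into (Tover C c) (Tcoord c) v)) ` Tcoord c ` (W \<inter> Tover C c) \<subseteq> - {0}"
      using assms(2) inv_into_f_f[OF inj_on_Tcoord[OF c]] by auto
  qed (auto intro!: holomorphic_intros)
qed

text \<open>In every chart of the atlas the pulled-back function depends on the first coordinate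
  only, and compatibility of charts carries its holomorphy over from \<open>d\<close>.\<close>

lemma Thol_base:
  assumes d: "d \<in> atlas C" and W: "openin (points C) W" "W \<subseteq> fst d" and f: "chart_hol d W f"
  shows "Thol C {x \<in> Tstar C. fst x \<in> W} (\<lambda>x. f (fst x))"
  unfolding Thol_iff[OF Topen_preimage[OF W(1)]]
proof
  fix c assume c: "c \<in> atlas C"
  have "chart_hol d (W \<inter> fst c) f"
    using f unfolding chart_hol_def by (rule holomorphic_on_subset) auto
  then have "chart_hol c (W \<inter> fst c) f"
    using W by (intro chart_hol_transfer[OF is_chart_atlas[OF c] is_chart_atlas[OF d]
        compatible_atlas[OF c d]]) auto
  then have hol: "(f \<circ> chart_inv c) holomorphic_on snd c ` (W \<inter> fst c)"
    by (simp add: chart_hol_def)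
  have op: "open (snd c ` (W \<inter> fst c))"
    using W openin_atlas[OF c] by (intro open_chart_image[OF is_chart_atlas[OF c]]) auto
  have "holomorphic2_on (\<lambda>v. (f \<circ> chart_inv c) (fst v))
      (Tcoord c ` ({x \<in> Tstar C. fst x \<in> W} \<inter> Tover C c))"
    by (rule holomorphic2_on_compose[OF hol op holomorphic2_on_fst])
      (auto simp: Tcoord_def Tover_def)
  moreover have "f (fst x) = (f \<circ> chart_inv c) (fst (Tcoord c x))" if "x \<in> Tover C c" for x
    using that chart_inv_left[OF is_chart_atlas[OF c]] by (simp add: Tcoord_def Tover_def)
  ultimately show "\<exists>G. holomorphic2_on G (Tcoord c ` ({x \<in> Tstar C. fst x \<in> W} \<inter> Tover C c)) \<and>
      (\<forall>x\<in>{x \<in> Tstar C. fst x \<in> W} \<inter> Tover C c. f (fst x) = G (Tcoord c x))"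
    by (intro exI[of _ "\<lambda>v. (f \<circ> chart_inv c) (fst v)"]) auto
qed

text \<open>In the coordinates of another chart \<open>c\<close>, the fibre coordinate of
  \<open>d\<close> is that of \<open>c\<close> divided by dz_d/dz_c. Dividing by this derivative,
  instead of multiplying by dz_c/dz_d, keeps all differentiation in the chart
  \<open>c\<close>.\<close>

lemma Thol_taut:
  assumes d: "d \<in> atlas C"
  shows "Thol C (Tover C d) (taut d)"
  unfolding Thol_iff[OF Topen_Tover[OF d]]
proof
  fix c assume c: "c \<in> atlas C"
  let ?D = "chart_deriv c (snd d) \<circ> chart_inv c"
  let ?S = "Tcoord c ` (Tover C d \<inter> Tover C c)"
  have chart: "is_chart (points C) c"
    using is_chart_atlas[OF c] .
  have hol: "?D holomorphic_on snd c ` (fst d \<inter> fst c)"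
    using chart_hol_transition_deriv[OF d c] by (simp add: chart_hol_def)
  have op: "open (snd c ` (fst d \<inter> fst c))"
    using openin_atlas[OF c] openin_atlas[OF d] by (intro open_chart_image[OF chart]) auto
  have D: "holomorphic2_on (\<lambda>v. ?D (fst v)) ?S"
    by (rule holomorphic2_on_compose[OF hol op holomorphic2_on_fst])
      (auto simp: Tcoord_def Tover_def)
  have nz: "?D (fst v) \<noteq> 0" if "v \<in> ?S" for v
  proof -
    obtain x where "v = Tcoord c x" "fst x \<in> fst d \<inter> fst c"
      using \<open>v \<in> ?S\<close> unfolding Tover_def by blast
    then show ?thesis
      using chart_inv_left[OF chart] chart_deriv_transition_nonzero[OF d c] by (simp add: Tcoord_def)
  qed
  have "holomorphic2_on (\<lambda>v. inverse (?D (fst v))) ?S"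
  proof (rule holomorphic2_on_compose[OF _ _ D])
    show "inverse holomorphic_on - {0::complex}"
      by (intro holomorphic_intros) auto
    show "open (- {0::complex})"
      by (simp add: open_Compl)
    show "(\<lambda>v. ?D (fst v)) ` ?S \<subseteq> - {0}"
      by (rule image_subsetI) (simp only: nz Compl_iff singleton_iff not_False_eq_True)
  qed
  then have "holomorphic2_on (\<lambda>v. snd v * inverse (?D (fst v))) ?S"
    by (intro holomorphic2_on_mult holomorphic2_on_snd)
  moreover have "taut d x = snd (Tcoord c x) * inverse (?D (fst (Tcoord c x)))"
    if x: "x \<in> Tover C d \<inter> Tover C c" for x
  proof -
    have "?D (fst (Tcoord c x)) = chart_deriv c (snd d) (fst x)"
      using x chart_inv_left[OF chart] by (simp add: Tcoord_def Tover_def)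
    moreover have "chart_deriv c (snd d) (fst x) \<noteq> 0"
      using chart_deriv_transition_nonzero[OF d c] x by (simp add: Tover_def)
    ultimately show ?thesis
      using taut_transition[OF x d c] by (simp add: Tcoord_def)
  qed
  ultimately show "\<exists>G. holomorphic2_on G ?S \<and> (\<forall>x\<in>Tover C d \<inter> Tover C c. taut d x = G (Tcoord c x))"
    by (intro exI[of _ "\<lambda>v. snd v * inverse (?D (fst v))"]) blast
qed

section \<open>Divisors given by local equations\<close>

lemma local_equation_cong:
  assumes "\<And>x. x \<in> W \<Longrightarrow> f x = g x"
  shows "local_equation C (W, f) \<longleftrightarrow> local_equation C (W, g)"
proof -
  have "(\<exists>x\<in>N. f x \<noteq> 0) \<longleftrightarrow> (\<exists>x\<in>N. g x \<noteq> 0)" if "N \<subseteq> W" for N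
    using that assms by (metis subsetD)
  then show ?thesis
    using Thol_cong[of W f g] assms unfolding local_equation_def by auto
qed

lemma same_divisorE:
  assumes "same_divisor C e e'" "x \<in> fst e \<inter> fst e'"
  obtains N u where "Topen C N" "x \<in> N" "N \<subseteq> fst e \<inter> fst e'" "Thol C N u"
    "\<And>x'. x' \<in> N \<Longrightarrow> u x' \<noteq> 0 \<and> snd e x' = u x' * snd e' x'"
  using assms unfolding same_divisor_def by blast

text \<open>A form of transitivity. The intermediate equation must be defined near the point in
  question, so a family whose domains cover the common domain takes the place of a single
  equation.\<close>

lemma same_divisor_through:
  assumes e: "\<And>\<alpha>. \<alpha> \<in> I \<Longrightarrow> same_divisor C e (S \<alpha>)"
    and e': "\<And>\<alpha>. \<alpha> \<in> I \<Longrightarrow> same_divisor C e' (S \<alpha>)"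
    and cover: "fst e \<inter> fst e' \<subseteq> (\<Union>\<alpha>\<in>I. fst (S \<alpha>))"
  shows "same_divisor C e e'"
  unfolding same_divisor_def
proof
  fix x assume x: "x \<in> fst e \<inter> fst e'"
  then obtain \<alpha> where \<alpha>: "\<alpha> \<in> I" "x \<in> fst (S \<alpha>)"
    using cover by blast
  obtain N u where N: "Topen C N" "x \<in> N" "N \<subseteq> fst e \<inter> fst (S \<alpha>)" "Thol C N u"
      "\<And>x'. x' \<in> N \<Longrightarrow> u x' \<noteq> 0 \<and> snd e x' = u x' * snd (S \<alpha>) x'"
    using same_divisorE[OF e[OF \<alpha>(1)]] x \<alpha>(2) by blast
  obtain N' u' where N': "Topen C N'" "x \<in> N'" "N' \<subseteq> fst e' \<inter> fst (S \<alpha>)" "Thol C N' u'"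
      "\<And>x'. x' \<in> N' \<Longrightarrow> u' x' \<noteq> 0 \<and> snd e' x' = u' x' * snd (S \<alpha>) x'"
    using same_divisorE[OF e'[OF \<alpha>(1)]] x \<alpha>(2) by blast
  \<comment> \<open>Both equations are unit multiples of the same \<open>S \<alpha>\<close>, so the
    quotient of the units relates them, even where \<open>S \<alpha>\<close> vanishes.\<close>
  let ?u = "\<lambda>x. u x * inverse (u' x)"
  have "Thol C (N \<inter> N') ?u"
    using N(4) N'(4,5) by (intro Thol_mult Thol_inverse) (auto elim: Thol_subset)
  moreover have "?u x' \<noteq> 0 \<and> snd e x' = ?u x' * snd e' x'" if "x' \<in> N \<inter> N'" for x'
    using that N(5)[of x'] N'(5)[of x'] by auto
  ultimately show "\<exists>N u. Topen C N \<and> x \<in> N \<and> N \<subseteq> fst e \<inter> fst e' \<and> Thol C N u \<and>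
      (\<forall>x'\<in>N. u x' \<noteq> 0 \<and> snd e x' = u x' * snd e' x')"
    using Topen_Int[OF N(1) N'(1)] N N' by (intro exI[of _ "N \<inter> N'"] exI[of _ ?u]) auto
qed

lemma effective_divisorD:
  assumes "effective_divisor C Z"
  shows "e \<in> Z \<Longrightarrow> local_equation C e"
    and "e \<in> Z \<Longrightarrow> e' \<in> Z \<Longrightarrow> same_divisor C e e'"
    and "local_equation C e \<Longrightarrow> (\<And>e'. e' \<in> Z \<Longrightarrow> same_divisor C e e') \<Longrightarrow> e \<in> Z"
  using assms unfolding effective_divisor_def by blast+

text \<open>Any two equations of the zero divisor are compared through the given ones, whose domains
  cover the bundle. The given ones are themselves members, so an equation compatible with all
  members passes the defining test, which is maximality.\<close>

lemma effective_divisor_zero_divisor_of: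
  assumes cover: "(\<Union>\<alpha>\<in>index P. Tover C (pchart P \<alpha>)) = Tstar C"
    and loc: "\<And>\<alpha>. \<alpha> \<in> index P \<Longrightarrow> local_equation C (Tover C (pchart P \<alpha>), s \<alpha>)"
    and glue: "\<And>\<alpha> \<beta>. \<alpha> \<in> index P \<Longrightarrow> \<beta> \<in> index P \<Longrightarrow>
      same_divisor C (Tover C (pchart P \<beta>), s \<beta>) (Tover C (pchart P \<alpha>), s \<alpha>)"
  shows "effective_divisor C (zero_divisor_of C P s)"
    and "effective_divisor C Z \<Longrightarrow>
      (\<And>\<alpha>. \<alpha> \<in> index P \<Longrightarrow> (Tover C (pchart P \<alpha>), s \<alpha>) \<in> Z) \<Longrightarrow> Z = zero_divisor_of C P s"
proof -
  let ?Z = "zero_divisor_of C P s"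
  let ?S = "\<lambda>\<alpha>. (Tover C (pchart P \<alpha>), s \<alpha>)"
  have S: "?S \<alpha> \<in> ?Z" if "\<alpha> \<in> index P" for \<alpha>
    using loc glue that by (simp add: zero_divisor_of_def)
  have sub: "fst e \<subseteq> Tstar C" if "local_equation C e" for e
    using that by (simp add: local_equation_def Topen_def)
  have same: "same_divisor C e e'" if "e \<in> ?Z" and loc': "local_equation C e'"
    and e': "\<And>\<alpha>. \<alpha> \<in> index P \<Longrightarrow> same_divisor C e' (?S \<alpha>)" for e e'
    by (rule same_divisor_through[where I = "index P" and S = ?S])
      (use that cover sub[OF loc'] in \<open>auto simp: zero_divisor_of_def\<close>)
  have "(\<Union>e\<in>?Z. fst e) = Tstar C"
  proof
    show "(\<Union>e\<in>?Z. fst e) \<subseteq> Tstar C"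
      using sub by (auto simp: zero_divisor_of_def)
    show "Tstar C \<subseteq> (\<Union>e\<in>?Z. fst e)"
      using S unfolding cover[symmetric] by fastforce
  qed
  moreover have "same_divisor C e e'" if "e \<in> ?Z" "e' \<in> ?Z" for e e'
    using same that by (simp add: zero_divisor_of_def)
  moreover have "\<forall>e\<in>?Z. local_equation C e"
    by (simp add: zero_divisor_of_def)
  moreover have "e \<in> ?Z" if "local_equation C e" "\<forall>e'\<in>?Z. same_divisor C e e'" for e
    using that S unfolding zero_divisor_of_def by blast
  ultimately show "effective_divisor C ?Z"
    unfolding effective_divisor_def by blast
  assume Z: "effective_divisor C Z" and SZ: "\<And>\<alpha>. \<alpha> \<in> index P \<Longrightarrow> ?S \<alpha> \<in> Z"
  show "Z = ?Z"
  proof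
    show *: "Z \<subseteq> ?Z"
      unfolding zero_divisor_of_def using effective_divisorD(1,2)[OF Z] SZ by blast
    show "?Z \<subseteq> Z"
    proof
      fix e assume e: "e \<in> ?Z"
      show "e \<in> Z"
      \<comment> \<open>By the first inclusion all members of \<open>Z\<close> pass the test against
        the given equations, so \<open>e\<close> is compatible with each of them and the maximality
        of \<open>Z\<close> admits it.\<close>
      proof (rule effective_divisorD(3)[OF Z])
        show "local_equation C e"
          using e by (simp add: zero_divisor_of_def)
        show "same_divisor C e e'" if "e' \<in> Z" for e'
          using same[OF e] * that unfolding zero_divisor_of_def by blast
      qed
    qed
  qed
qed

text \<open>Membership in \<open>Z\<close> concerns total functions, whereas a symbol is determined
  only over its domain. Maximality of \<open>Z\<close> makes the values elsewhere
  immaterial.\<close>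

lemma effective_divisor_cong:
  assumes Z: "effective_divisor C Z" and f: "(W, f) \<in> Z" and fg: "\<And>x. x \<in> W \<Longrightarrow> f x = g x"
  shows "(W, g) \<in> Z"
proof (rule effective_divisorD(3)[OF Z])
  show "local_equation C (W, g)"
    using effective_divisorD(1)[OF Z f] local_equation_cong[of W f g, OF fg] by simp
  fix e' assume "e' \<in> Z"
  then have same: "same_divisor C (W, f) e'"
    using effective_divisorD(2)[OF Z f] by simp
  show "same_divisor C (W, g) e'"
    unfolding same_divisor_def
  proof
    fix x assume "x \<in> fst (W, g) \<inter> fst e'"
    then have "x \<in> fst (W, f) \<inter> fst e'"
      by simp
    then obtain N u where N: "Topen C N" "x \<in> N" "N \<subseteq> fst (W, f) \<inter> fst e'" "Thol C N u"
        "\<And>x'. x' \<in> N \<Longrightarrow> u x' \<noteq> 0 \<and> snd (W, f) x' = u x' * snd e' x'"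
      using same_divisorE[OF same] by blast
    have "u x' \<noteq> 0 \<and> snd (W, g) x' = u x' * snd e' x'" if "x' \<in> N" for x'
      using N(5)[OF that] N(3) that fg[of x'] by fastforce
    then show "\<exists>N u. Topen C N \<and> x \<in> N \<and> N \<subseteq> fst (W, g) \<inter> fst e' \<and> Thol C N u \<and>
        (\<forall>x'\<in>N. u x' \<noteq> 0 \<and> snd (W, g) x' = u x' * snd e' x')"
      using N(1-4) by (intro exI[of _ N] exI[of _ u]) auto
  qed
qed

section \<open>The equation of a quadratic differential\<close>

lemma Thol_quadratic:
  assumes q: "q \<in> H0_K C 2" and c: "c \<in> atlas C"
  shows "Thol C (Tover C c) (\<lambda>x. (taut c x)\<^sup>2 - q c (fst x))"
proof -
  have "chart_hol c (fst c) (q c)"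
    using q c by (simp add: H0_K_def)
  then have "Thol C (Tover C c) (\<lambda>x. q c (fst x))"
    using Thol_base[OF c openin_atlas[OF c]] by (simp add: Tover_def)
  then show ?thesis
    unfolding power2_eq_square by (intro Thol_diff Thol_mult Thol_taut c)
qed

text \<open>The point is that the function vanishes identically on no nonempty open set: on each
  fibre it is a monic quadratic polynomial, with finitely many zeros.\<close>

lemma local_equation_quadratic:
  assumes q: "q \<in> H0_K C 2" and c: "c \<in> atlas C"
  shows "local_equation C (Tover C c, \<lambda>x. (taut c x)\<^sup>2 - q c (fst x))"
proof -
  have "\<exists>x\<in>N. (taut c x)\<^sup>2 - q c (fst x) \<noteq> 0"
    if N: "Topen C N" "N \<subseteq> Tover C c" "x\<^sub>0 \<in> N" for N x\<^sub>0
  proof (rule ccontr)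
    assume *: "\<not> ?thesis"
    \<comment> \<open>The slice of \<open>N\<close> along the fibre through the chosen point: open,
      nonempty, and by assumption contained in a finite set of square roots.\<close>
    define V where "V = {w. (snd c (fst x\<^sub>0), w) \<in> Tcoord c ` N}"
    have "open (Tcoord c ` N)"
      using N c by (metis Topen_def Int_absorb2)
    then have "open V"
      unfolding V_def using open_vimage[of "Tcoord c ` N" "\<lambda>w. (snd c (fst x\<^sub>0), w)"]
      by (simp add: vimage_def continuous_on_Pair)
    moreover have "taut c x\<^sub>0 \<in> V"
      using N by (auto simp: V_def Tcoord_def)
    moreover have "V \<subseteq> {w. w\<^sup>2 = q c (fst x\<^sub>0)}"
    proof
      fix w assume "w \<in> V"
      then obtain x where x: "x \<in> N" "snd c (fst x) = snd c (fst x\<^sub>0)" "taut c x = w"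
        by (auto simp: V_def Tcoord_def)
      then have "fst x = fst x\<^sub>0"
        using N chart_inj[OF is_chart_atlas[OF c]] by (auto simp: Tover_def dest: inj_onD)
      then show "w \<in> {w. w\<^sup>2 = q c (fst x\<^sub>0)}"
        using * x by auto
    qed
    moreover have "finite {w. w\<^sup>2 = q c (fst x\<^sub>0)}"
      using finite_nth_roots[of 2 "q c (fst x\<^sub>0)"] by simp
    ultimately show False
      using finite_imp_not_open finite_subset by blast
  qed
  then show ?thesis
    using Topen_Tover[OF c] Thol_quadratic[OF q c] by (auto simp: local_equation_def)
qed

text \<open>Both terms are components of sections of the square of the canonical bundle, so each is
  multiplied by the square of the transition derivative, which is a unit on the overlap.\<close>

lemma same_divisor_quadratic:
  assumes q: "q \<in> H0_K C 2" and c: "c \<in> atlas C" and d: "d \<in> atlas C"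
  shows "same_divisor C (Tover C d, \<lambda>x. (taut d x)\<^sup>2 - q d (fst x))
    (Tover C c, \<lambda>x. (taut c x)\<^sup>2 - q c (fst x))"
proof -
  let ?N = "Tover C d \<inter> Tover C c" and ?u = "\<lambda>x. (chart_deriv d (snd c) (fst x))\<^sup>2"
  have N: "?N = {x \<in> Tstar C. fst x \<in> fst c \<inter> fst d}"
    by (auto simp: Tover_def)
  have "Thol C ?N (\<lambda>x. chart_deriv d (snd c) (fst x))"
    unfolding N using openin_atlas[OF c] openin_atlas[OF d]
    by (intro Thol_base[OF d _ _ chart_hol_transition_deriv[OF c d]]) auto
  then have u: "Thol C ?N ?u"
    unfolding power2_eq_square by (intro Thol_mult)
  have "?u x \<noteq> 0 \<and> (taut d x)\<^sup>2 - q d (fst x) = ?u x * ((taut c x)\<^sup>2 - q c (fst x))" if x: "x \<in> ?N" for x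
  proof -
    have p: "fst x \<in> fst c \<inter> fst d"
      using x by (auto simp: Tover_def)
    have "q d (fst x) = q c (fst x) * ?u x"
      using q c d p unfolding H0_K_def by blast
    moreover have "taut d x = taut c x * chart_deriv d (snd c) (fst x)"
      using taut_transition[OF _ c d] x by blast
    ultimately show ?thesis
      using chart_deriv_transition_nonzero[OF c d p] by (simp add: algebra_simps power_mult_distrib)
  qed
  then show ?thesis
    unfolding same_divisor_def using Topen_Int[OF Topen_Tover[OF d] Topen_Tover[OF c]] u
    by (intro ballI exI[of _ ?N] exI[of _ ?u]) auto
qed

section \<open>The semi-classical symbol\<close>

text \<open>Here \<open>a\<close> stands for \<open>1 / h\<close>. The first claim supplies the
  holomorphy that \<open>scalar_op_oper_module\<close> requires.\<close>

lemma chart_deriv2_exp: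
  assumes c: "c \<in> atlas C" and S: "chart_hol c (fst c) S" and p: "p \<in> fst c"
  shows "chart_hol c (fst c) (\<lambda>p. exp (a * S p))"
    and "chart_deriv c (chart_deriv c (\<lambda>p. exp (a * S p))) p =
      (a * chart_deriv c (chart_deriv c S) p + (a * chart_deriv c S p)\<^sup>2) * exp (a * S p)"
proof -
  note ch = is_chart_atlas[OF c] and op = openin_atlas[OF c]
  show hol: "chart_hol c (fst c) (\<lambda>p. exp (a * S p))"
    using S unfolding chart_hol_def o_def by (intro holomorphic_intros)
  let ?T = "S \<circ> chart_inv c" and ?T' = "chart_deriv c S \<circ> chart_inv c"
  have T: "(?T has_field_derivative chart_deriv c S p') (at (snd c p'))"
    and T': "(?T' has_field_derivative chart_deriv c (chart_deriv c S) p') (at (snd c p'))"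
    if "p' \<in> fst c" for p'
    using chart_has_deriv[OF ch op order_refl S that]
      chart_has_deriv[OF ch op order_refl chart_hol_deriv[OF ch op order_refl S] that] .
  have inv: "chart_inv c (snd c p') = p'" if "p' \<in> fst c" for p'
    using chart_inv_left[OF ch that] .
  \<comment> \<open>The first derivative is needed at every point of the domain, because it is
    differentiated again.\<close>
  have d1: "chart_deriv c (\<lambda>p. exp (a * S p)) p' = a * chart_deriv c S p' * exp (a * S p')"
    if p': "p' \<in> fst c" for p'
    by (rule chart_deriv_eqI[OF ch op order_refl p', where G = "\<lambda>z. exp (a * ?T z)"])
      (use T[OF p', unfolded o_def] inv p' in \<open>auto intro!: derivative_eq_intros\<close>)
  show "chart_deriv c (chart_deriv c (\<lambda>p. exp (a * S p))) p =
      (a * chart_deriv c (chart_deriv c S) p + (a * chart_deriv c S p)\<^sup>2) * exp (a * S p)"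
    by (rule chart_deriv_eqI[OF ch op order_refl p, where G = "\<lambda>z. a * ?T' z * exp (a * ?T z)"])
      (use T[OF p, unfolded o_def] T'[OF p, unfolded o_def] inv p d1 in
        \<open>auto intro!: derivative_eq_intros simp: algebra_simps power2_eq_square\<close>)
qed

end

text \<open>No linear term in the fibre coordinate appears because \<open>phi\<close> has trace
  0.\<close>

lemma char_section_hitchin_section:
  "char_section P (hitchin_section P \<kappa> q) \<alpha> x = (taut (pchart P \<alpha>) x)\<^sup>2 - q (pchart P \<alpha>) (fst x)"
  by (simp add: char_section_def hitchin_section_def phi_def det_2 mat_def power2_eq_square)


lemma semiclassical_symbol_oper_module:
  assumes C: "riemann_surface C" and P: "projective_coordinate_system C P"
    and \<kappa>: "theta_characteristic P \<kappa>" and q: "q \<in> H0_K C 2"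
    and xi: "\<And>\<alpha> \<beta> p. \<alpha> \<in> index P \<Longrightarrow> \<beta> \<in> index P \<Longrightarrow>
      p \<in> fst (pchart P \<alpha>) \<inter> fst (pchart P \<beta>) \<Longrightarrow> \<kappa> \<alpha> \<beta> p = xi P \<alpha> \<beta> p"
    and \<alpha>: "\<alpha> \<in> index P"
  shows "semiclassical_symbol C P (oper_module P \<kappa> q) \<alpha> F \<longleftrightarrow>
    (\<forall>x\<in>Tover C (pchart P \<alpha>). F x = (taut (pchart P \<alpha>) x)\<^sup>2 - q (pchart P \<alpha>) (fst x))"
proof -
  let ?c = "pchart P \<alpha>"
  have c: "?c \<in> atlas C"
    using P \<alpha> by (auto simp: projective_coordinate_system_def)
  note ch = is_chart_atlas[OF C c] and op = openin_atlas[OF C c]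
  let ?f = "\<lambda>S x h. exp (- (1 / h) * S (fst x)) *
      scalar_op P (oper_module P \<kappa> q) h \<alpha> (\<lambda>p. exp ((1 / h) * S p)) (fst x)"
  have lim: "(?f S x \<longlongrightarrow> (taut ?c x)\<^sup>2 - q ?c (fst x)) (at 0)"
    if x: "x \<in> Tover C ?c" and S: "chart_hol ?c (fst ?c) S"
      and S': "chart_deriv ?c S (fst x) = taut ?c x" for x S
  proof -
    let ?S'' = "chart_deriv ?c (chart_deriv ?c S) (fst x)"
    have p: "fst x \<in> fst ?c"
      using x by (simp add: Tover_def)
    \<comment> \<open>For nonzero \<open>h\<close> the identity is exact. The second derivative of
      \<open>S\<close> enters only with a factor \<open>h\<close>, so the limit depends on the
      covector alone.\<close>
    have f: "?f S x h = (taut ?c x)\<^sup>2 + h * ?S'' - q ?c (fst x)" if "h \<noteq> 0" for h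
    proof -
      have "scalar_op P (oper_module P \<kappa> q) h \<alpha> (\<lambda>p. exp ((1 / h) * S p)) (fst x) =
          h\<^sup>2 * chart_deriv ?c (chart_deriv ?c (\<lambda>p. exp ((1 / h) * S p))) (fst x) -
          q ?c (fst x) * exp ((1 / h) * S (fst x))"
        by (rule scalar_op_oper_module[OF C P \<kappa> q xi \<alpha> p that chart_deriv2_exp(1)[OF C c S p]])
      also have "\<dots> = (h\<^sup>2 * (1 / h * ?S'' + (1 / h * taut ?c x)\<^sup>2) - q ?c (fst x)) * exp ((1 / h) * S (fst x))"
        unfolding chart_deriv2_exp(2)[OF C c S p] S' by (simp only: left_diff_distrib mult.assoc)
      also have "h\<^sup>2 * (1 / h * ?S'' + (1 / h * taut ?c x)\<^sup>2) = (taut ?c x)\<^sup>2 + h * ?S''"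
        using that by (simp add: field_simps power2_eq_square)
      finally have "scalar_op P (oper_module P \<kappa> q) h \<alpha> (\<lambda>p. exp ((1 / h) * S p)) (fst x) =
          ((taut ?c x)\<^sup>2 + h * ?S'' - q ?c (fst x)) * exp ((1 / h) * S (fst x))" .
      moreover have "exp (- (1 / h) * S (fst x)) * exp ((1 / h) * S (fst x)) = 1"
        by (simp flip: exp_add)
      ultimately show ?thesis
        by (simp only: mult.left_commute[of "exp (- (1 / h) * S (fst x))"] mult_1_right)
    qed
    have "((\<lambda>h. (taut ?c x)\<^sup>2 + h * ?S'' - q ?c (fst x)) \<longlongrightarrow>
        (taut ?c x)\<^sup>2 + 0 * ?S'' - q ?c (fst x)) (at 0)"
      by (intro tendsto_intros)
    \<comment> \<open>The filter \<open>at 0\<close> omits \<open>h = 0\<close>, where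
      \<open>1 / h\<close> is a default value and the formula is not claimed.\<close>
    moreover have "\<forall>\<^sub>F h in at 0. (taut ?c x)\<^sup>2 + h * ?S'' - q ?c (fst x) = ?f S x h"
      using f by (auto simp: eventually_at_filter)
    ultimately show ?thesis
      using Lim_transform_eventually by fastforce
  qed
  \<comment> \<open>If no \<open>S\<close> were admissible at \<open>x\<close>, the symbol condition
    there would be vacuous and \<open>F x\<close> undetermined. A multiple of the coordinate has the
    prescribed derivative.\<close>
  have ex: "\<exists>S. chart_hol ?c (fst ?c) S \<and> chart_deriv ?c S (fst x) = taut ?c x"
    if x: "x \<in> Tover C ?c" for x
  proof (intro exI conjI)
    let ?S = "\<lambda>p. taut ?c x * snd ?c p"
    have p: "fst x \<in> fst ?c"
      using x by (simp add: Tover_def)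
    show "chart_deriv ?c ?S (fst x) = taut ?c x"
      by (rule chart_deriv_eqI[OF ch op order_refl p, where G = "\<lambda>z. taut ?c x * z"])
        (auto intro!: derivative_eq_intros)
    have "(\<lambda>z. taut ?c x * z) holomorphic_on snd ?c ` fst ?c"
      by (intro holomorphic_intros)
    then show "chart_hol ?c (fst ?c) ?S"
      unfolding chart_hol_def
      by (rule holomorphic_transform) (use chart_inv_left[OF ch] in auto)
  qed
  show ?thesis
    unfolding semiclassical_symbol_def
  proof (intro iffI ballI allI impI)
    fix x assume F: "\<forall>x\<in>Tover C ?c. \<forall>S. chart_hol ?c (fst ?c) S \<and>
        chart_deriv ?c S (fst x) = taut ?c x \<longrightarrow> (?f S x \<longlongrightarrow> F x) (at 0)"
      and x: "x \<in> Tover C ?c"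
    then obtain S where S: "chart_hol ?c (fst ?c) S" "chart_deriv ?c S (fst x) = taut ?c x"
      using ex by blast
    then have "(?f S x \<longlongrightarrow> F x) (at 0)"
      using F x by blast
    then show "F x = (taut ?c x)\<^sup>2 - q ?c (fst x)"
      using lim[OF x S] tendsto_unique trivial_limit_at by blast
  next
    fix x S assume "\<forall>x\<in>Tover C ?c. F x = (taut ?c x)\<^sup>2 - q ?c (fst x)" "x \<in> Tover C ?c"
      "chart_hol ?c (fst ?c) S \<and> chart_deriv ?c S (fst x) = taut ?c x"
    then show "(?f S x \<longlongrightarrow> F x) (at 0)"
      using lim by simp
  qed
qed

section \<open>Comparison of the limit divisor with the spectral curve\<close>

theorem theorem9p1:
  fixes C :: "'p surface" and P :: "('i, 'p) projective_coords"
    and \<kappa> :: "'i \<Rightarrow> 'i \<Rightarrow> 'p \<Rightarrow> complex" and q :: "'p chart \<Rightarrow> 'p \<Rightarrow> complex" and g :: nat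
    and Z :: "'p local_eq set"
  assumes "compact_riemann_surface C" and "has_genus C g" and "g \<ge> 2"
    and "projective_coordinate_system C P"
    and "theta_characteristic P \<kappa>"
    and "\<And>\<alpha> \<beta> p. \<alpha> \<in> index P \<Longrightarrow> \<beta> \<in> index P \<Longrightarrow> p \<in> fst (pchart P \<alpha>) \<inter> fst (pchart P \<beta>) \<Longrightarrow>
           \<kappa> \<alpha> \<beta> p = xi P \<alpha> \<beta> p"
    and "q \<in> H0_K C 2"
  shows "semiclassical_limit C P (oper_module P \<kappa> q) Z \<longleftrightarrow>
         Z = spectral_curve C P (hitchin_section P \<kappa> q)"
proof -
  have C: "riemann_surface C"
    using assms(1) by (simp add: compact_riemann_surface_def)
  define s where "s \<alpha> = (\<lambda>x. (taut (pchart P \<alpha>) x)\<^sup>2 - q (pchart P \<alpha>) (fst x))" for \<alpha>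
  have atl: "pchart P \<alpha> \<in> atlas C" if "\<alpha> \<in> index P" for \<alpha>
    using assms(4) that by (auto simp: projective_coordinate_system_def)
  have "(\<Union>\<alpha>\<in>index P. fst (pchart P \<alpha>)) = topspace (points C)"
    using assms(4) unfolding projective_coordinate_system_def by (elim conjE)
  then have cover: "(\<Union>\<alpha>\<in>index P. Tover C (pchart P \<alpha>)) = Tstar C"
    using Tstar_fst[OF C] by (fastforce simp: Tover_def)
  have loc: "local_equation C (Tover C (pchart P \<alpha>), s \<alpha>)" if "\<alpha> \<in> index P" for \<alpha>
    unfolding s_def using local_equation_quadratic[OF C assms(7) atl[OF that]] .
  have glue: "same_divisor C (Tover C (pchart P \<beta>), s \<beta>) (Tover C (pchart P \<alpha>), s \<alpha>)"
    if "\<alpha> \<in> index P" "\<beta> \<in> index P" for \<alpha> \<beta>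
    unfolding s_def using same_divisor_quadratic[OF C assms(7) atl atl] that .
  have spec: "spectral_curve C P (hitchin_section P \<kappa> q) = zero_divisor_of C P s"
    unfolding spectral_curve_def zero_divisor_of_def s_def
    by (simp add: char_section_hitchin_section[abs_def])
  have sym: "semiclassical_symbol C P (oper_module P \<kappa> q) \<alpha> F \<longleftrightarrow>
      (\<forall>x\<in>Tover C (pchart P \<alpha>). F x = s \<alpha> x)" if "\<alpha> \<in> index P" for \<alpha> F
    unfolding s_def using semiclassical_symbol_oper_module[OF C assms(4,5,7,6) that] .
  show ?thesis
    unfolding spec
  proof
    assume L: "semiclassical_limit C P (oper_module P \<kappa> q) Z"
    then have Z: "effective_divisor C Z"
      by (simp add: semiclassical_limit_def)
    \<comment> \<open>The limit supplies some symbol \<open>F\<close> in \<open>Z\<close>. It agrees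
      with \<open>s \<alpha>\<close> over the chart, and \<open>effective_divisor_cong\<close>
      replaces it by \<open>s \<alpha>\<close>.\<close>
    have sZ: "(Tover C (pchart P \<alpha>), s \<alpha>) \<in> Z" if "\<alpha> \<in> index P" for \<alpha>
      using L that sym[OF that] effective_divisor_cong[OF C Z]
      unfolding semiclassical_limit_def by blast
    show "Z = zero_divisor_of C P s"
      by (rule effective_divisor_zero_divisor_of(2)[OF C cover loc glue Z sZ])
  next
    assume Z: "Z = zero_divisor_of C P s"
    have "effective_divisor C Z"
      unfolding Z by (rule effective_divisor_zero_divisor_of(1)[OF C cover loc glue])
    \<comment> \<open>Conversely, \<open>s \<alpha>\<close> itself serves as the symbol.\<close>
    moreover have "(Tover C (pchart P \<alpha>), s \<alpha>) \<in> Z" if "\<alpha> \<in> index P" for \<alpha>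
      using loc glue that by (simp add: Z zero_divisor_of_def)
    ultimately show "semiclassical_limit C P (oper_module P \<kappa> q) Z"
      using sym unfolding semiclassical_limit_def by blast
  qed
qed

end
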